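(* Let $(M^{r,3-r},\phi,\xi,\eta,g)$, $r\in\{0,1\}$, be a three-dimensional pseudo-Riemannian Sasakian space-form with $\phi$-sectional curvature $H$ and scalar curvature $S$. Let $\psi$ be a non-null Sasakian quasi-Killing spinor (SqK-spinor) of type $(a,b)$ as in one of the following cases, with the indicated $\lambda,\Lambda$, where $\lambda\neq0$ and $S-6\Lambda\neq0$: (i) $(a,b)=\left(\frac{(-1)^r}{2},\frac{H-(-1)^r}{4}\right)$, $\lambda=\frac{(-1)^{r-1}H-5}{4}$, $\Lambda=(-1)^{r-1}$; (ii) $(-1)^rH>-3$, $(a,b)=\left(\frac{(-1)^r}{2}+\frac{\sqrt{(-1)^rH+3}}{2},-\frac{\sqrt{(-1)^rH+3}}{2}+(-1)^{r-1}\right)$, $\lambda=(-1)^{r-1}\sqrt{(-1)^rH+3}-\frac12$, $\Lambda=-\sqrt{3+(-1)^rH}+H+(-1)^r2$; (iii) $(-1)^rH>-3$, $(a,b)=\left(\frac{(-1)^r}{2}-\frac{\sqrt{(-1)^rH+3}}{2},\frac{\sqrt{(-1)^rH+3}}{2}+(-1)^{r-1}\right)$, $\lambda=(-1)^{r}\sqrt{(-1)^rH+3}-\frac12$, $\Lambda=\sqrt{3+(-1)^rH}+H+(-1)^r2$. Only in the Riemannian case ($r=0$) of (ii), assume in addition that $H<1$. Then the pair $$\left(g,\ \sqrt{-\frac{S-6\Lambda}{\lambda\langle\psi,\psi\rangle}}\;\psi\right)$$ is a solution to the Einstein-Dirac (ED) system with the corresponding eigenvalue $\lambda$ and cosmological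 constant $\Lambda$ in each case.
   Context: Write $\mathrm{i}=\sqrt{-1}$; $r=0$ is the Riemannian case and $r=1$ the Lorentzian case. A Sasakian manifold is a contact metric manifold $(M,\phi,\xi,\eta,g)$ with Reeb field $\xi$, $\eta(\xi)=1$, satisfying $R(X,Y)\xi=\eta(Y)X-\eta(X)Y$; Lorentzian-Sasakian manifolds are obtained from Riemannian ones by replacing the metric $g'$ by $g'-2\eta\otimes\eta$, so $g(\xi,\xi)=(-1)^r$. The $\phi$-sectional curvature is $K(X,\phi X)$, $X\perp\xi$; a Sasakian space-form is a simply connected Sasakian manifold with constant $\phi$-sectional curvature $H$. In dimension three its Ricci tensor is $\mathrm{Ric}=(H+(-1)^r)g+(1-(-1)^rH)\eta\otimes\eta$. In dimension three there is a global orthonormal frame (Sasakian frame) $e_1=\xi,e_2,e_3$, $g(e_i,e_j)=h_{ij}$, $h=\mathrm{diag}((-1)^r,1,1)$, with $[e_1,e_2]=-\frac{H+(-1)^r3}{2}e_3$, $[e_1,e_3]=\frac{H+(-1)^r3}{2}e_2$, $[e_2,e_3]=-2e_1$; the dual coframe is $\omega^1=\eta,\omega^2,\omega^3$. Indices are raised with $h$. Spinors: with respect to a Sasakian frame spinor fields are $\mathbb{C}^2$-valued functions, and $e_j$ acts by Clifford multiplication via $\gamma_1=(-\mathrm{i})^{r-1}\sigma_1$, $\gamma_2=\mathrm{i}\sigma_2$, $\gamma_3=\mathrm{i}\sigma_3$ ($\sigma_j$ the Pauli matrices). The spin connection is $\nabla_X\psi=X(\psi)+\omega^S(X)\psi$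 with $\omega^S=\frac{(-\mathrm{i})^r}{2}\sum_j\omega^j\gamma_j+\mathrm{i}^r\frac{H+(-1)^{r-1}}{4}\omega^1\gamma_1$. The Spin-invariant form is $\langle\psi_1,\psi_2\rangle=\psi_1^\dagger(\gamma_1)^r\psi_2$; for an SqK-spinor $\langle\psi,\psi\rangle$ is constant, and non-null means $\langle\psi,\psi\rangle\neq0$. An SqK-spinor of type $(a,b)$, $a,b\in\mathbb{R}$, is a spinor field with $\nabla_X\psi=a\,\mathrm{i}^rX\cdot\psi+b\,\mathrm{i}^r\eta(X)\xi\cdot\psi$ for all $X$. ED system (dimension 3): $(g,\psi)$ is a solution with eigenvalue $\lambda\in\mathbb{R}$ and cosmological constant $\Lambda\in\mathbb{R}$ if $D\psi=\lambda\psi$, where $D=\mathrm{i}^r\sum_j\gamma^j\nabla_{e_j}$, and $\mathrm{Ric}=T-\mathrm{tr}(T)g+2\Lambda g$, where $$T(X,Y)=T^{spin}(X,Y)=\tfrac14\mathrm{Re}\langle\psi,\mathrm{i}^r(X\cdot\nabla_Y\psi+Y\cdot\nabla_X\psi)\rangle.$$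
   Formalization: In the Lorentzian case (r=1) it is additionally assumed that -(S-6Λ)/(λ⟨ψ,ψ⟩) is nonnegative, so the square root is real; for negative values the claim fails, e.g. case (i) with constant ψ and ⟨ψ,ψ⟩>0. *)

theory Defs
  imports "HOL-Analysis.Analysis"
begin

section \<open>Smooth 3-manifolds\<close>

text \<open>Used only for open \<open>S\<close>.\<close>

primrec Ck_on ::
    "nat \<Rightarrow> 'a::euclidean_space set \<Rightarrow> ('a \<Rightarrow> 'b::real_normed_vector) \<Rightarrow> bool" where
  "Ck_on 0 S f \<longleftrightarrow> continuous_on S f"
| "Ck_on (Suc k) S f \<longleftrightarrow>
     f differentiable_on S \<and> (\<forall>v. Ck_on k S (\<lambda>x. frechet_derivative f (at x) v))"

definition smooth_on ::
    "'a::euclidean_space set \<Rightarrow> ('a \<Rightarrow> 'b::real_normed_vector) \<Rightarrow> bool" where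
  "smooth_on S f \<longleftrightarrow> (\<forall>k. Ck_on k S f)"

text \<open>
  The underlying set of the manifold is the whole type \<open>'m\<close>; its smooth structure is given by a
  (not necessarily maximal) atlas of charts \<open>(U, c)\<close>, where \<open>c\<close> matters only on \<open>U\<close>.
\<close>

type_synonym 'm atlas = "('m set \<times> ('m \<Rightarrow> real ^ 3)) set"

definition smooth_atlas :: "('m::{t2_space, second_countable_topology}) atlas \<Rightarrow> bool" where
  "smooth_atlas A \<longleftrightarrow>
     (\<Union>(U, c)\<in>A. U) = UNIV \<and>
     (\<forall>(U, c)\<in>A. open U \<and> open (c ` U) \<and> homeomorphism U (c ` U) c (inv_into U c)) \<and>
     (\<forall>(U, c)\<in>A. \<forall>(V, d)\<in>A. smooth_on (c ` (U \<inter> V)) (d \<circ> inv_into U c))"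

definition smooth :: "'m atlas \<Rightarrow> ('m \<Rightarrow> 'b::real_normed_vector) \<Rightarrow> bool" where
  "smooth A f \<longleftrightarrow> (\<forall>(U, c)\<in>A. smooth_on (c ` U) (f \<circ> inv_into U c))"

section \<open>Vector fields and tensors\<close>

text \<open>
  Smooth vector fields are the derivations of the algebra of smooth functions. They are extended
  by zero to non-smooth functions, so that equality of vector fields is equality in HOL.
\<close>

type_synonym 'm vfield = "('m \<Rightarrow> real) \<Rightarrow> 'm \<Rightarrow> real"

definition vfields :: "'m atlas \<Rightarrow> 'm vfield set" where
  "vfields A = {X.
     (\<forall>f. smooth A f \<longrightarrow> smooth A (X f)) \<and>
     (\<forall>f. \<not> smooth A f \<longrightarrow> X f = (\<lambda>p. 0)) \<and>
     (\<forall>f g. smooth A f \<longrightarrow> smooth A g \<longrightarrow> X (\<lambda>p. f p + g p) = (\<lambda>p. X f p + X g p)) \<and>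
     (\<forall>c f. smooth A f \<longrightarrow> X (\<lambda>p. c * f p) = (\<lambda>p. c * X f p)) \<and>
     (\<forall>f g. smooth A f \<longrightarrow> smooth A g \<longrightarrow>
        X (\<lambda>p. f p * g p) = (\<lambda>p. X f p * g p + f p * X g p))}"

definition vadd :: "'m vfield \<Rightarrow> 'm vfield \<Rightarrow> 'm vfield" where
  "vadd X Y = (\<lambda>f p. X f p + Y f p)"

definition vdiff :: "'m vfield \<Rightarrow> 'm vfield \<Rightarrow> 'm vfield" where
  "vdiff X Y = (\<lambda>f p. X f p - Y f p)"

definition vscale :: "('m \<Rightarrow> real) \<Rightarrow> 'm vfield \<Rightarrow> 'm vfield" where
  "vscale u X = (\<lambda>f p. u p * X f p)"

definition lie_bracket :: "'m vfield \<Rightarrow> 'm vfield \<Rightarrow> 'm vfield" where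
  "lie_bracket X Y = (\<lambda>f p. X (Y f) p - Y (X f) p)"

definition nonzero_at :: "'m vfield \<Rightarrow> 'm \<Rightarrow> bool" where
  "nonzero_at X p \<longleftrightarrow> (\<exists>f. X f p \<noteq> 0)"

text \<open>Smooth tensor fields are maps on vector fields that are linear over smooth functions.\<close>

definition one_form :: "'m atlas \<Rightarrow> ('m vfield \<Rightarrow> 'm \<Rightarrow> real) \<Rightarrow> bool" where
  "one_form A \<alpha> \<longleftrightarrow>
     (\<forall>X\<in>vfields A. smooth A (\<alpha> X)) \<and>
     (\<forall>X\<in>vfields A. \<forall>Y\<in>vfields A. \<alpha> (vadd X Y) = (\<lambda>p. \<alpha> X p + \<alpha> Y p)) \<and>
     (\<forall>u. \<forall>X\<in>vfields A. smooth A u \<longrightarrow> \<alpha> (vscale u X) = (\<lambda>p. u p * \<alpha> X p))"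

definition endomorphism_field :: "'m atlas \<Rightarrow> ('m vfield \<Rightarrow> 'm vfield) \<Rightarrow> bool" where
  "endomorphism_field A L \<longleftrightarrow>
     (\<forall>X\<in>vfields A. L X \<in> vfields A) \<and>
     (\<forall>X\<in>vfields A. \<forall>Y\<in>vfields A. L (vadd X Y) = vadd (L X) (L Y)) \<and>
     (\<forall>u. \<forall>X\<in>vfields A. smooth A u \<longrightarrow> L (vscale u X) = vscale u (L X))"

type_synonym 'm metric = "'m vfield \<Rightarrow> 'm vfield \<Rightarrow> 'm \<Rightarrow> real"

definition riemannian_metric :: "'m atlas \<Rightarrow> 'm metric \<Rightarrow> bool" where
  "riemannian_metric A g \<longleftrightarrow>
     (\<forall>X\<in>vfields A. one_form A (g X)) \<and>
     (\<forall>X\<in>vfields A. \<forall>Y\<in>vfields A. g X Y = g Y X) \<and>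
     (\<forall>X\<in>vfields A. \<forall>p. nonzero_at X p \<longrightarrow> g X X p > 0)"

section \<open>Connection and curvature\<close>

type_synonym 'm connection = "'m vfield \<Rightarrow> 'm vfield \<Rightarrow> 'm vfield"

definition affine_connection :: "'m atlas \<Rightarrow> 'm connection \<Rightarrow> bool" where
  "affine_connection A nabla \<longleftrightarrow>
     (\<forall>X\<in>vfields A. \<forall>Y\<in>vfields A. nabla X Y \<in> vfields A) \<and>
     (\<forall>X\<in>vfields A. \<forall>Y\<in>vfields A. \<forall>Z\<in>vfields A.
        nabla (vadd X Y) Z = vadd (nabla X Z) (nabla Y Z) \<and>
        nabla X (vadd Y Z) = vadd (nabla X Y) (nabla X Z)) \<and>
     (\<forall>u. \<forall>X\<in>vfields A. \<forall>Y\<in>vfields A. smooth A u \<longrightarrow>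
        nabla (vscale u X) Y = vscale u (nabla X Y) \<and>
        nabla X (vscale u Y) = vadd (vscale (X u) Y) (vscale u (nabla X Y)))"

definition levi_civita :: "'m atlas \<Rightarrow> 'm metric \<Rightarrow> 'm connection \<Rightarrow> bool" where
  "levi_civita A g nabla \<longleftrightarrow>
     affine_connection A nabla \<and>
     (\<forall>X\<in>vfields A. \<forall>Y\<in>vfields A. vdiff (nabla X Y) (nabla Y X) = lie_bracket X Y) \<and>
     (\<forall>X\<in>vfields A. \<forall>Y\<in>vfields A. \<forall>Z\<in>vfields A.
        X (g Y Z) = (\<lambda>p. g (nabla X Y) Z p + g Y (nabla X Z) p))"

definition curvature ::
    "'m connection \<Rightarrow> 'm vfield \<Rightarrow> 'm vfield \<Rightarrow> 'm vfield \<Rightarrow> 'm vfield" where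
  "curvature nabla X Y Z =
     vdiff (vdiff (nabla X (nabla Y Z)) (nabla Y (nabla X Z))) (nabla (lie_bracket X Y) Z)"

definition sectional ::
    "'m metric \<Rightarrow> 'm connection \<Rightarrow> 'm vfield \<Rightarrow> 'm vfield \<Rightarrow> 'm \<Rightarrow> real" where
  "sectional g nabla X Y p =
     g (curvature nabla X Y Y) X p / (g X X p * g Y Y p - (g X Y p)\<^sup>2)"

section \<open>Sasakian structures\<close>

text \<open>
  The factor \<open>1/2\<close> is the convention for the exterior derivative used in contact metric geometry;
  it is the one compatible with the Sasakian condition \<open>R(X,Y)\<xi> = \<eta>(Y)X - \<eta>(X)Y\<close> and with
  \<open>[e\<^sub>2,e\<^sub>3] = -2e\<^sub>1\<close> in a Sasakian frame.
\<close>

definition ext_deriv ::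
    "('m vfield \<Rightarrow> 'm \<Rightarrow> real) \<Rightarrow> 'm vfield \<Rightarrow> 'm vfield \<Rightarrow> 'm \<Rightarrow> real" where
  "ext_deriv \<alpha> X Y p = (X (\<alpha> Y) p - Y (\<alpha> X) p - \<alpha> (lie_bracket X Y) p) / 2"

definition contact_metric ::
    "'m atlas \<Rightarrow> ('m vfield \<Rightarrow> 'm vfield) \<Rightarrow> 'm vfield \<Rightarrow> ('m vfield \<Rightarrow> 'm \<Rightarrow> real) \<Rightarrow> 'm metric \<Rightarrow> bool"
  where
  "contact_metric A \<phi> \<xi> \<eta> g \<longleftrightarrow>
     riemannian_metric A g \<and> endomorphism_field A \<phi> \<and> \<xi> \<in> vfields A \<and> one_form A \<eta> \<and>
     \<eta> \<xi> = (\<lambda>p. 1) \<and>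
     (\<forall>X\<in>vfields A. \<phi> (\<phi> X) = vdiff (vscale (\<eta> X) \<xi>) X) \<and>
     (\<forall>X\<in>vfields A. \<forall>Y\<in>vfields A. \<forall>p. g (\<phi> X) (\<phi> Y) p = g X Y p - \<eta> X p * \<eta> Y p) \<and>
     (\<forall>X\<in>vfields A. \<forall>Y\<in>vfields A. \<forall>p. ext_deriv \<eta> X Y p = g X (\<phi> Y) p)"

definition riemannian_sasakian ::
    "'m atlas \<Rightarrow> ('m vfield \<Rightarrow> 'm vfield) \<Rightarrow> 'm vfield \<Rightarrow> ('m vfield \<Rightarrow> 'm \<Rightarrow> real) \<Rightarrow> 'm metric \<Rightarrow> bool"
  where
  "riemannian_sasakian A \<phi> \<xi> \<eta> g \<longleftrightarrow>
     contact_metric A \<phi> \<xi> \<eta> g \<and>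
     (\<exists>nabla. levi_civita A g nabla \<and>
        (\<forall>X\<in>vfields A. \<forall>Y\<in>vfields A.
           curvature nabla X Y \<xi> = vdiff (vscale (\<eta> Y) X) (vscale (\<eta> X) Y)))"

text \<open>\<open>r = 0\<close>: Riemannian; \<open>r = 1\<close>: Lorentzian.\<close>

definition sasakian ::
    "nat \<Rightarrow> 'm atlas \<Rightarrow> ('m vfield \<Rightarrow> 'm vfield) \<Rightarrow> 'm vfield \<Rightarrow> ('m vfield \<Rightarrow> 'm \<Rightarrow> real) \<Rightarrow> 'm metric
       \<Rightarrow> bool" where
  "sasakian r A \<phi> \<xi> \<eta> g \<longleftrightarrow>
     (\<exists>g'. riemannian_sasakian A \<phi> \<xi> \<eta> g' \<and>
        (\<forall>X\<in>vfields A. \<forall>Y\<in>vfields A. \<forall>p. g X Y p = g' X Y p - 2 * real r * \<eta> X p * \<eta> Y p))"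

definition sasakian_space_form ::
    "nat \<Rightarrow> ('m::{t2_space, second_countable_topology}) atlas \<Rightarrow> ('m vfield \<Rightarrow> 'm vfield) \<Rightarrow>
       'm vfield \<Rightarrow> ('m vfield \<Rightarrow> 'm \<Rightarrow> real) \<Rightarrow> 'm metric \<Rightarrow> 'm connection \<Rightarrow> real \<Rightarrow> bool" where
  "sasakian_space_form r A \<phi> \<xi> \<eta> g nabla H \<longleftrightarrow>
     smooth_atlas A \<and> simply_connected (UNIV :: 'm set) \<and>
     sasakian r A \<phi> \<xi> \<eta> g \<and> levi_civita A g nabla \<and>
     (\<forall>X\<in>vfields A. \<forall>p. nonzero_at X p \<and> g X \<xi> p = 0 \<longrightarrow> sectional g nabla X (\<phi> X) p = H)"

section \<open>Sasakian frames, Ricci and scalar curvature\<close>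

definition frame :: "'m atlas \<Rightarrow> (3 \<Rightarrow> 'm vfield) \<Rightarrow> bool" where
  "frame A e \<longleftrightarrow>
     (\<forall>j. e j \<in> vfields A) \<and>
     (\<forall>X\<in>vfields A. \<exists>!u :: 3 \<Rightarrow> 'm \<Rightarrow> real.
        (\<forall>j. smooth A (u j)) \<and> X = (\<lambda>f p. \<Sum>j\<in>UNIV. u j p * e j f p))"

text \<open>The diagonal of \<open>h\<close>; since \<open>h\<close> is its own inverse, it also serves to raise indices.\<close>

definition hdiag :: "nat \<Rightarrow> 3 \<Rightarrow> real" where
  "hdiag r j = (if j = 1 then (-1) ^ r else 1)"

definition sasakian_frame ::
    "nat \<Rightarrow> real \<Rightarrow> 'm atlas \<Rightarrow> 'm vfield \<Rightarrow> 'm metric \<Rightarrow> (3 \<Rightarrow> 'm vfield) \<Rightarrow> bool" where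
  "sasakian_frame r H A \<xi> g e \<longleftrightarrow>
     frame A e \<and> e 1 = \<xi> \<and>
     (\<forall>i j. g (e i) (e j) = (\<lambda>p. if i = j then hdiag r i else 0)) \<and>
     lie_bracket (e 1) (e 2) = vscale (\<lambda>p. - (H + (-1) ^ r * 3) / 2) (e 3) \<and>
     lie_bracket (e 1) (e 3) = vscale (\<lambda>p. (H + (-1) ^ r * 3) / 2) (e 2) \<and>
     lie_bracket (e 2) (e 3) = vscale (\<lambda>p. - 2) (e 1)"

text \<open>For an orthonormal frame the dual coframe is \<open>\<omega>\<^sup>j = h\<^sup>j\<^sup>j g(e\<^sub>j, \<cdot>)\<close>.\<close>

definition coframe ::
    "nat \<Rightarrow> 'm metric \<Rightarrow> (3 \<Rightarrow> 'm vfield) \<Rightarrow> 3 \<Rightarrow> 'm vfield \<Rightarrow> 'm \<Rightarrow> real" where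
  "coframe r g e j X p = hdiag r j * g (e j) X p"

text \<open>\<open>Ric(Y,Z)\<close> is the trace of \<open>X \<mapsto> R(X,Y)Z\<close>, taken in the frame \<open>e\<close>.\<close>

definition ricci ::
    "nat \<Rightarrow> 'm metric \<Rightarrow> (3 \<Rightarrow> 'm vfield) \<Rightarrow> 'm connection \<Rightarrow> 'm vfield \<Rightarrow> 'm vfield \<Rightarrow> 'm \<Rightarrow> real"
  where
  "ricci r g e nabla Y Z p = (\<Sum>j\<in>UNIV. coframe r g e j (curvature nabla (e j) Y Z) p)"

definition metric_trace ::
    "nat \<Rightarrow> (3 \<Rightarrow> 'm vfield) \<Rightarrow> ('m vfield \<Rightarrow> 'm vfield \<Rightarrow> 'm \<Rightarrow> real) \<Rightarrow> 'm \<Rightarrow> real" where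
  "metric_trace r e B p = (\<Sum>j\<in>UNIV. hdiag r j * B (e j) (e j) p)"

definition scalar_curvature ::
    "nat \<Rightarrow> 'm metric \<Rightarrow> (3 \<Rightarrow> 'm vfield) \<Rightarrow> 'm connection \<Rightarrow> 'm \<Rightarrow> real" where
  "scalar_curvature r g e nabla = metric_trace r e (ricci r g e nabla)"

section \<open>Spinors\<close>

text \<open>
  All spinor notions are relative to the Sasakian frame \<open>e\<close>, which trivialises the spinor bundle.
\<close>

type_synonym 'm spinor = "'m \<Rightarrow> complex ^ 2"

definition cscale :: "complex \<Rightarrow> complex ^ 2 ^ 2 \<Rightarrow> complex ^ 2 ^ 2" where
  "cscale c M = map_matrix (\<lambda>z. c * z) M"

definition pauli1 :: "complex ^ 2 ^ 2" where
  "pauli1 = vector [vector [0, 1], vector [1, 0]]"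

definition pauli2 :: "complex ^ 2 ^ 2" where
  "pauli2 = vector [vector [0, - \<i>], vector [\<i>, 0]]"

definition pauli3 :: "complex ^ 2 ^ 2" where
  "pauli3 = vector [vector [1, 0], vector [0, - 1]]"

definition gam :: "nat \<Rightarrow> 3 \<Rightarrow> complex ^ 2 ^ 2" where
  "gam r j =
     (if j = 1 then cscale ((- \<i>) powi (int r - 1)) pauli1
      else if j = 2 then cscale \<i> pauli2
      else cscale \<i> pauli3)"

definition clifford ::
    "nat \<Rightarrow> 'm metric \<Rightarrow> (3 \<Rightarrow> 'm vfield) \<Rightarrow> 'm vfield \<Rightarrow> 'm spinor \<Rightarrow> 'm spinor" where
  "clifford r g e X \<psi> p =
     (\<Sum>j\<in>UNIV. complex_of_real (coframe r g e j X p) *s (gam r j *v \<psi> p))"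

definition spinor_deriv :: "'m vfield \<Rightarrow> 'm spinor \<Rightarrow> 'm spinor" where
  "spinor_deriv X \<psi> p =
     (\<chi> k. Complex (X (\<lambda>q. Re (\<psi> q $ k)) p) (X (\<lambda>q. Im (\<psi> q $ k)) p))"

text \<open>
  The lift to spinors of the Levi-Civita connection form of a Sasakian frame, whose coefficients
  depend only on \<open>H\<close> and \<open>r\<close>.
\<close>

definition omegaS ::
    "nat \<Rightarrow> real \<Rightarrow> 'm metric \<Rightarrow> (3 \<Rightarrow> 'm vfield) \<Rightarrow> 'm vfield \<Rightarrow> 'm \<Rightarrow> complex ^ 2 ^ 2" where
  "omegaS r H g e X p =
     cscale ((- \<i>) ^ r / 2) (\<Sum>j\<in>UNIV. cscale (complex_of_real (coframe r g e j X p)) (gam r j)) +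
     cscale (\<i> ^ r * complex_of_real ((H + (-1) powi (int r - 1)) / 4 * coframe r g e 1 X p))
       (gam r 1)"

definition spin_nabla ::
    "nat \<Rightarrow> real \<Rightarrow> 'm metric \<Rightarrow> (3 \<Rightarrow> 'm vfield) \<Rightarrow> 'm vfield \<Rightarrow> 'm spinor \<Rightarrow> 'm spinor" where
  "spin_nabla r H g e X \<psi> p = spinor_deriv X \<psi> p + omegaS r H g e X p *v \<psi> p"

text \<open>
  The form is \<open>\<psi>\<^sub>1\<^sup>\<dagger> (\<gamma>\<^sub>1)\<^sup>r \<psi>\<^sub>2\<close>; the power of \<open>\<gamma>\<^sub>1\<close> is written as iterated application because \<open>^\<close> on
  the type of matrices is componentwise. The form is Hermitian.
\<close>

definition spin_form :: "nat \<Rightarrow> complex ^ 2 \<Rightarrow> complex ^ 2 \<Rightarrow> complex" where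
  "spin_form r v w = (\<Sum>k\<in>UNIV. cnj (v $ k) * ((((*v) (gam r 1)) ^^ r) w) $ k)"

definition sqk_spinor ::
    "nat \<Rightarrow> real \<Rightarrow> 'm atlas \<Rightarrow> 'm vfield \<Rightarrow> ('m vfield \<Rightarrow> 'm \<Rightarrow> real) \<Rightarrow> 'm metric \<Rightarrow>
       (3 \<Rightarrow> 'm vfield) \<Rightarrow> real \<Rightarrow> real \<Rightarrow> 'm spinor \<Rightarrow> bool" where
  "sqk_spinor r H A \<xi> \<eta> g e a b \<psi> \<longleftrightarrow>
     smooth A \<psi> \<and>
     (\<forall>X\<in>vfields A. \<forall>p. spin_nabla r H g e X \<psi> p =
        (complex_of_real a * \<i> ^ r) *s clifford r g e X \<psi> p +
        (complex_of_real b * \<i> ^ r * complex_of_real (\<eta> X p)) *s clifford r g e \<xi> \<psi> p)"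

section \<open>The Einstein-Dirac system\<close>

definition dirac ::
    "nat \<Rightarrow> real \<Rightarrow> 'm metric \<Rightarrow> (3 \<Rightarrow> 'm vfield) \<Rightarrow> 'm spinor \<Rightarrow> 'm spinor" where
  "dirac r H g e \<psi> p =
     \<i> ^ r *s (\<Sum>j\<in>UNIV. complex_of_real (hdiag r j) *s (gam r j *v spin_nabla r H g e (e j) \<psi> p))"

definition T_spin ::
    "nat \<Rightarrow> real \<Rightarrow> 'm metric \<Rightarrow> (3 \<Rightarrow> 'm vfield) \<Rightarrow> 'm spinor \<Rightarrow>
       'm vfield \<Rightarrow> 'm vfield \<Rightarrow> 'm \<Rightarrow> real" where
  "T_spin r H g e \<psi> X Y p =
     1 / 4 * Re (spin_form r (\<psi> p)
       (\<i> ^ r *s (clifford r g e X (spin_nabla r H g e Y \<psi>) p +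
                  clifford r g e Y (spin_nabla r H g e X \<psi>) p)))"

definition ED_solution ::
    "nat \<Rightarrow> real \<Rightarrow> 'm atlas \<Rightarrow> 'm metric \<Rightarrow> (3 \<Rightarrow> 'm vfield) \<Rightarrow> 'm connection \<Rightarrow> 'm spinor \<Rightarrow>
       real \<Rightarrow> real \<Rightarrow> bool" where
  "ED_solution r H A g e nabla \<psi> lam Lam \<longleftrightarrow>
     smooth A \<psi> \<and>
     (\<forall>p. dirac r H g e \<psi> p = complex_of_real lam *s \<psi> p) \<and>
     (\<forall>X\<in>vfields A. \<forall>Y\<in>vfields A. \<forall>p.
        ricci r g e nabla X Y p =
          T_spin r H g e \<psi> X Y p - metric_trace r e (T_spin r H g e \<psi>) p * g X Y p
          + 2 * Lam * g X Y p)"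

end

theory Submission
  imports Defs
begin

text \<open>
  Write \<open>\<epsilon> = (-1)\<^sup>r\<close>. Koszul's formula in the Sasakian frame gives \<open>Ric = (H + \<epsilon>) g + (1 - \<epsilon>H) \<eta> \<otimes> \<eta>\<close>.
  For an SqK-spinor of type \<open>(a,b)\<close> the Clifford relations give \<open>D\<psi> = -\<epsilon>(3a + b)\<psi>\<close> and
  \<open>T = -\<langle>\<psi>,\<psi>\<rangle>/2 (\<epsilon>a g + b \<eta> \<otimes> \<eta>)\<close>, so the Einstein equation reduces to two scalar equations for the
  constant \<open>\<langle>\<psi>,\<psi>\<rangle>\<close>, which is normalised to \<open>-(S - 6\<Lambda>)/\<lambda>\<close>. That \<open>\<langle>\<psi>,\<psi>\<rangle>\<close> is constant holds because
  every vector field annihilates it; as vector fields are global derivations, this yields a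
  vanishing derivative in charts only after multiplying coordinate fields by bump functions.
\<close>

section \<open>Closure properties of smooth functions\<close>

text \<open>The normalisation comes from tracing the Einstein equation: in dimension three it reads
  \<open>S - 6 * Lam = - 2 * tr T\<close>, and for an SqK-spinor \<open>tr T = lam * N / 2\<close>,
  where \<open>N\<close> is the value of the spin form. So \<open>N\<close> must be
  \<open>- (S - 6 * Lam) / lam\<close>, and the coefficient of \<eta> \<otimes> \<eta> is then the
  one independent condition left; it ties \<open>(a,b)\<close> to \<open>H\<close>. With
  \<open>s = sqrt (\<epsilon> * H + 3)\<close> the three cases have \<open>N = 8\<epsilon>\<close>,
  \<open>4(2\<epsilon> - s)\<close> and \<open>4(2\<epsilon> + s)\<close>. For \<open>r = 0\<close>
  the form is positive definite, so a real scaling factor needs \<open>N > 0\<close>; in the second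
  case this is \<open>s < 2\<close>, that is \<open>H < 1\<close>. For \<open>r = 1\<close> the form
  is indefinite and the sign of the radicand is a hypothesis. The connection form and the SqK
  right-hand side are both \<open>\<i> ^ r\<close> times Clifford multiplication by a real vector.
  Such operators are skew for the spin form, which yields both the constancy of the form and the
  shape of \<open>T\<close>.\<close>

lemma Ck_on_has_derivative:
  assumes "open S" "Ck_on (Suc k) S f" "x \<in> S"
  shows "(f has_derivative frechet_derivative f (at x)) (at x)"
  using assms by (auto simp: differentiable_on_eq_differentiable_at frechet_derivative_works)

lemma Ck_on_cong:
  assumes S: "open S" and "\<And>x. x \<in> S \<Longrightarrow> f x = g x" "Ck_on k S f"
  shows "Ck_on k S g"
  using assms(2,3)
proof (induction k arbitrary: f g)
  case 0
  then show ?case using continuous_on_cong[of S S f g] by simp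
next
  case (Suc k)
  have g: "(g has_derivative frechet_derivative f (at x)) (at x)" if "x \<in> S" for x
    by (rule has_derivative_transform_within_open[OF Ck_on_has_derivative[OF S Suc.prems(2) that] S that])
      (simp add: Suc.prems)
  have "g differentiable_on S"
    unfolding differentiable_on_eq_differentiable_at[OF S] differentiable_def using g by blast
  moreover have "Ck_on k S (\<lambda>x. frechet_derivative g (at x) v)" for v
  proof (rule Suc.IH)
    show "Ck_on k S (\<lambda>x. frechet_derivative f (at x) v)" using Suc.prems by simp
  qed (simp add: frechet_derivative_at[OF g])
  ultimately show ?case by simp
qed

text \<open>Derivatives at points of an open set are unique, so an explicit candidate
  \<open>f'\<close> may replace the choice-based \<open>frechet_derivative\<close>. The closure
  rules below use this form.\<close>

lemma Ck_on_SucI: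
  assumes S: "open S" and f: "\<And>x. x \<in> S \<Longrightarrow> (f has_derivative f' x) (at x)"
    and f': "\<And>v. Ck_on k S (\<lambda>x. f' x v)"
  shows "Ck_on (Suc k) S f"
proof -
  have "f differentiable_on S"
    unfolding differentiable_on_eq_differentiable_at[OF S] differentiable_def using f by blast
  moreover have "Ck_on k S (\<lambda>x. frechet_derivative f (at x) v)" for v
    by (rule Ck_on_cong[OF S _ f'[of v]]) (simp add: frechet_derivative_at[OF f])
  ultimately show ?thesis by simp
qed

lemma Ck_on_subset: "Ck_on k S f \<Longrightarrow> T \<subseteq> S \<Longrightarrow> Ck_on k T f"
  by (induction k arbitrary: f) (auto intro: continuous_on_subset differentiable_on_subset)

text \<open>Continuity and differentiability are local, and so is each iterated derivative. This
  glues functions that have different descriptions on different open sets.\<close>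

lemma Ck_on_local:
  assumes "\<And>x. x \<in> S \<Longrightarrow> \<exists>T. open T \<and> x \<in> T \<and> Ck_on k T f"
  shows "Ck_on k S f"
  using assms
proof (induction k arbitrary: f)
  case 0
  have "continuous (at x within S) f" if "x \<in> S" for x
    using 0[OF that] by (auto simp: continuous_on_eq_continuous_at intro: continuous_at_imp_continuous_at_within)
  then show ?case by (simp add: continuous_on_eq_continuous_within)
next
  case (Suc k)
  have "f differentiable (at x within S)" if "x \<in> S" for x
    using Suc.prems[OF that]
    by (auto simp: differentiable_on_eq_differentiable_at intro: differentiable_at_withinI)
  moreover have "Ck_on k S (\<lambda>x. frechet_derivative f (at x) v)" for v
    by (rule Suc.IH) (use Suc.prems in fastforce)
  ultimately show ?case by (simp add: differentiable_on_def)
qed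

lemma Ck_on_Suc_imp: "Ck_on (Suc k) S f \<Longrightarrow> Ck_on k S f"
  by (induction k arbitrary: f) (auto intro: differentiable_imp_continuous_on)

lemma Ck_on_const: "open S \<Longrightarrow> Ck_on k S (\<lambda>x. c)"
proof (induction k arbitrary: c)
  case (Suc k)
  show ?case
    by (rule Ck_on_SucI[where f' = "\<lambda>x v. 0"]) (use Suc in auto)
qed simp

lemma Ck_on_bounded_linear:
  assumes L: "bounded_linear L" and S: "open S" and "Ck_on k S f"
  shows "Ck_on k S (\<lambda>x. L (f x))"
  using assms(3)
proof (induction k arbitrary: f)
  case 0
  then show ?case
    using bounded_linear.continuous_on[OF L] by simp
next
  case (Suc k)
  show ?case
  proof (rule Ck_on_SucI[where f' = "\<lambda>x v. L (frechet_derivative f (at x) v)"])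
    show "((\<lambda>x. L (f x)) has_derivative (\<lambda>v. L (frechet_derivative f (at x) v))) (at x)"
      if "x \<in> S" for x
      by (rule bounded_linear.has_derivative[OF L Ck_on_has_derivative[OF S Suc.prems that]])
  qed (use Suc S in auto)
qed

lemma Ck_on_add:
  assumes S: "open S" and "Ck_on k S f" "Ck_on k S g"
  shows "Ck_on k S (\<lambda>x. f x + g x)"
  using assms(2,3)
proof (induction k arbitrary: f g)
  case 0
  then show ?case by (auto intro: continuous_intros)
next
  case (Suc k)
  show ?case
    by (rule Ck_on_SucI[where f' = "\<lambda>x v. frechet_derivative f (at x) v + frechet_derivative g (at x) v"])
      (use Suc S in \<open>auto intro!: has_derivative_add Ck_on_has_derivative\<close>)
qed

lemma Ck_on_scaleR:
  assumes S: "open S" and "Ck_on k S f" "Ck_on k S g"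
  shows "Ck_on k S (\<lambda>x. f x *\<^sub>R g x)"
  using assms(2,3)
proof (induction k arbitrary: f g)
  case 0
  then show ?case by (auto intro: continuous_intros)
next
  case (Suc k)
  show ?case
  proof (rule Ck_on_SucI[where f' = "\<lambda>x v. f x *\<^sub>R frechet_derivative g (at x) v + frechet_derivative f (at x) v *\<^sub>R g x"])
    show "((\<lambda>x. f x *\<^sub>R g x) has_derivative
      (\<lambda>v. f x *\<^sub>R frechet_derivative g (at x) v + frechet_derivative f (at x) v *\<^sub>R g x)) (at x)"
      if "x \<in> S" for x
      using has_derivative_scaleR[OF Ck_on_has_derivative[OF S Suc.prems(1) that] Ck_on_has_derivative[OF S Suc.prems(2) that]]
      by simp
  next
    \<comment> \<open>The undifferentiated factors are weakened by one order, so that the induction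
      hypothesis covers each product.\<close>
    have *: "Ck_on k S f" "Ck_on k S g" using Suc.prems Ck_on_Suc_imp by blast+
    show "Ck_on k S (\<lambda>x. f x *\<^sub>R frechet_derivative g (at x) v + frechet_derivative f (at x) v *\<^sub>R g x)" for v
      by (intro Ck_on_add[OF S] Suc.IH) (use Suc.prems * in auto)
  qed (rule S)
qed

lemma Ck_on_sum:
  assumes "open S" "finite I" "\<And>i. i \<in> I \<Longrightarrow> Ck_on k S (f i)"
  shows "Ck_on k S (\<lambda>x. \<Sum>i\<in>I. f i x)"
  using assms(2,3)
  by (induction I rule: finite_induct) (auto intro: Ck_on_const[OF assms(1)] Ck_on_add[OF assms(1)])

lemma Ck_on_id: "open S \<Longrightarrow> Ck_on k S (\<lambda>x. x)"
proof (cases k)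
  case (Suc j)
  assume S: "open S"
  show ?thesis unfolding Suc
    by (rule Ck_on_SucI[where f' = "\<lambda>x v. v"]) (use S in \<open>auto intro: Ck_on_const\<close>)
qed simp

lemma Ck_on_compose:
  fixes g :: "'a::euclidean_space \<Rightarrow> 'b::euclidean_space"
  assumes S: "open S" and T: "open T" and sub: "\<And>x. x \<in> S \<Longrightarrow> g x \<in> T"
    and "Ck_on k S g" "Ck_on k T f"
  shows "Ck_on k S (\<lambda>x. f (g x))"
  using assms(4,5)
proof (induction k arbitrary: f)
  case 0
  then show ?case
    using continuous_on_compose2[of T f S g] sub by auto
next
  case (Suc k)
  \<comment> \<open>In the chain rule the direction fed to the derivative of \<open>f\<close> varies
    with \<open>x\<close>, while \<open>Ck_on\<close> controls fixed directions only. Expanding that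
    direction in \<open>Basis\<close> leaves fixed directions \<open>b\<close> and scalar
    factors.\<close>
  let ?D = "\<lambda>x v. \<Sum>b\<in>Basis. (frechet_derivative g (at x) v \<bullet> b) *\<^sub>R frechet_derivative f (at (g x)) b"
  show ?case
  proof (rule Ck_on_SucI[where f' = ?D])
    fix x assume x: "x \<in> S"
    have f: "(f has_derivative frechet_derivative f (at (g x))) (at (g x))"
      using Ck_on_has_derivative[OF T Suc.prems(2) sub[OF x]] .
    have lin: "linear (frechet_derivative f (at (g x)))"
      using f has_derivative_linear by blast
    have "frechet_derivative f (at (g x)) (frechet_derivative g (at x) v) = ?D x v" for v
    proof -
      have "frechet_derivative f (at (g x)) (frechet_derivative g (at x) v) =
        frechet_derivative f (at (g x)) (\<Sum>b\<in>Basis. (frechet_derivative g (at x) v \<bullet> b) *\<^sub>R b)"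
        by (simp add: euclidean_representation)
      also have "\<dots> = ?D x v"
        by (simp add: linear_sum[OF lin] linear_scale[OF lin])
      finally show ?thesis .
    qed
    then show "((\<lambda>x. f (g x)) has_derivative ?D x) (at x)"
      using diff_chain_at[OF Ck_on_has_derivative[OF S Suc.prems(1) x] f] by (simp add: o_def)
  next
    fix v
    have g: "Ck_on k S g" using Suc.prems(1) Ck_on_Suc_imp by blast
    show "Ck_on k S (\<lambda>x. ?D x v)"
    proof (intro Ck_on_sum[OF S] Ck_on_scaleR[OF S] finite_Basis)
      fix b :: 'b
      show "Ck_on k S (\<lambda>x. frechet_derivative g (at x) v \<bullet> b)"
        by (rule Ck_on_bounded_linear[OF bounded_linear_inner_left S]) (use Suc.prems in simp)
      show "Ck_on k S (\<lambda>x. frechet_derivative f (at (g x)) b)"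
        by (rule Suc.IH[OF g]) (use Suc.prems in simp)
    qed
  qed (rule S)
qed

section \<open>A flat function and bump functions on Euclidean space\<close>

definition flat_exp :: "nat \<Rightarrow> real \<Rightarrow> real" where
  "flat_exp n t = (if t > 0 then exp (- inverse t) * inverse t ^ n else 0)"

text \<open>From the right, substituting the inverse of \<open>t\<close> reduces this to the
  exponential outgrowing every power.\<close>

lemma flat_exp_tendsto_0: "(flat_exp n \<longlongrightarrow> 0) (at 0)"
proof (rule filterlim_split_at)
  have "((\<lambda>y::real. y ^ n / exp y) \<longlongrightarrow> 0) at_top"
    by (rule tendsto_power_div_exp_0)
  then have "((\<lambda>t::real. (inverse t) ^ n / exp (inverse t)) \<longlongrightarrow> 0) (at_right 0)"
    by (rule filterlim_compose) (rule filterlim_inverse_at_top_right)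
  moreover have "\<forall>\<^sub>F t in at_right 0. (inverse t) ^ n / exp (inverse t) = flat_exp n t"
    by (auto simp: eventually_at_filter flat_exp_def divide_inverse exp_minus mult.commute)
  ultimately show "(flat_exp n \<longlongrightarrow> 0) (at_right 0)"
    by (rule Lim_transform_eventually)
  have "\<forall>\<^sub>F t in at_left 0. 0 = flat_exp n t"
    by (auto simp: eventually_at_filter flat_exp_def)
  then show "(flat_exp n \<longlongrightarrow> 0) (at_left 0)"
    by (rule Lim_transform_eventually[OF tendsto_const])
qed

text \<open>The index \<open>n\<close> exists for this formula: the family is closed under
  differentiation up to linear combinations, so smoothness follows by induction over all
  \<open>n\<close> at once.\<close>

lemma flat_exp_deriv:
  "(flat_exp n has_real_derivative flat_exp (n + 2) t - real n * flat_exp (n + 1) t) (at t)"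
proof -
  consider "t > 0" | "t = 0" | "t < 0" by linarith
  then show ?thesis
  proof cases
    case 1
    have "((\<lambda>t. exp (- inverse t) * inverse t ^ n) has_real_derivative
        exp (- inverse t) * (inverse t * inverse t) * inverse t ^ n
        - exp (- inverse t) * (real n * inverse t ^ (n - 1) * (inverse t * inverse t))) (at t)"
      using 1 by (auto intro!: derivative_eq_intros simp: algebra_simps)
    moreover have "exp (- inverse t) * (inverse t * inverse t) * inverse t ^ n
        - exp (- inverse t) * (real n * inverse t ^ (n - 1) * (inverse t * inverse t)) =
        flat_exp (n + 2) t - real n * flat_exp (n + 1) t"
      using 1 by (cases n) (simp_all add: flat_exp_def)
    ultimately have "((\<lambda>t. exp (- inverse t) * inverse t ^ n) has_real_derivative
        flat_exp (n + 2) t - real n * flat_exp (n + 1) t) (at t)"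
      by simp
    then show ?thesis
      by (rule has_field_derivative_transform_within_open[where S = "{0<..}"])
        (use 1 in \<open>auto simp: flat_exp_def\<close>)
  next
    case 2
    \<comment> \<open>Dividing by \<open>h\<close> only raises the index: the quotient at 0 is
      \<open>flat_exp (n + 1) h\<close>.\<close>
    have "((\<lambda>h. (flat_exp n (0 + h) - flat_exp n 0) / h) \<longlongrightarrow> 0) (at 0)"
      by (rule Lim_transform_eventually[OF flat_exp_tendsto_0[of "n + 1"]])
        (auto simp: eventually_at_filter flat_exp_def divide_inverse mult_ac)
    then show ?thesis
      unfolding DERIV_def using 2 by (simp add: flat_exp_def)
  next
    case 3
    have "((\<lambda>t. 0) has_real_derivative flat_exp (n + 2) t - real n * flat_exp (n + 1) t) (at t)"
      using 3 by (simp add: flat_exp_def)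
    then show ?thesis
      by (rule has_field_derivative_transform_within_open[where S = "{..<0}"])
        (use 3 in \<open>auto simp: flat_exp_def\<close>)
  qed
qed

lemma Ck_on_flat_exp: "Ck_on k UNIV (flat_exp n)"
proof (induction k arbitrary: n)
  case 0
  then show ?case
    using DERIV_isCont[OF flat_exp_deriv] by (auto intro!: continuous_at_imp_continuous_on)
next
  case (Suc k)
  show ?case
  proof (rule Ck_on_SucI[where f' = "\<lambda>t v. v *\<^sub>R (flat_exp (n + 2) t + (- real n) *\<^sub>R flat_exp (n + 1) t)"])
    show "(flat_exp n has_derivative
       (\<lambda>v. v *\<^sub>R (flat_exp (n + 2) t + (- real n) *\<^sub>R flat_exp (n + 1) t))) (at t)" for t
      using flat_exp_deriv[of n t] by (simp add: has_field_derivative_def mult.commute[of _ "flat_exp _ _ - _"])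
  qed (intro open_UNIV Ck_on_scaleR Ck_on_add Ck_on_const Suc.IH)+
qed

text \<open>The squared norm is used because the norm itself is not differentiable at the
  centre.\<close>

definition bump :: "'a::euclidean_space \<Rightarrow> real \<Rightarrow> 'a \<Rightarrow> real" where
  "bump c \<epsilon> x = flat_exp 0 (\<epsilon>\<^sup>2 - (norm (x - c))\<^sup>2)"

lemma Ck_on_bump: "Ck_on k UNIV (bump c \<epsilon>)"
proof -
  have id: "Ck_on k UNIV (\<lambda>x. x - c)"
    using Ck_on_add[OF open_UNIV Ck_on_id[OF open_UNIV] Ck_on_const[OF open_UNIV], of k "- c"] by simp
  have "Ck_on k UNIV (\<lambda>x. \<epsilon>\<^sup>2 + (\<Sum>b\<in>Basis. ((x - c) \<bullet> b) *\<^sub>R (- ((x - c) \<bullet> b))))"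
    by (intro Ck_on_add Ck_on_sum Ck_on_scaleR Ck_on_const open_UNIV finite_Basis
        Ck_on_bounded_linear[OF bounded_linear_inner_left _ id]
        Ck_on_bounded_linear[OF bounded_linear_minus[OF bounded_linear_inner_left] _ id])
  also have "(\<lambda>x. \<epsilon>\<^sup>2 + (\<Sum>b\<in>Basis. ((x - c) \<bullet> b) *\<^sub>R (- ((x - c) \<bullet> b)))) =
    (\<lambda>x. \<epsilon>\<^sup>2 - (norm (x - c))\<^sup>2)"
    unfolding power2_norm_eq_inner
    by (subst (3) euclidean_inner) (simp add: sum_negf)
  finally show ?thesis
    unfolding bump_def
    using Ck_on_compose[OF open_UNIV open_UNIV UNIV_I _ Ck_on_flat_exp] by blast
qed

lemma bump_pos: "x \<in> ball c \<epsilon> \<Longrightarrow> bump c \<epsilon> x > 0"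
  by (auto simp: bump_def flat_exp_def dist_norm norm_minus_commute power_strict_mono)

lemma bump_eq_0: "\<epsilon> > 0 \<Longrightarrow> x \<notin> cball c \<epsilon> \<Longrightarrow> bump c \<epsilon> x = 0"
  using power2_less_imp_less[of "norm (x - c)" \<epsilon>]
  by (fastforce simp: bump_def flat_exp_def dist_norm norm_minus_commute)

section \<open>Functions annihilated by all vector fields\<close>

lemma smooth_on_chart: "smooth A f \<Longrightarrow> (U, c) \<in> A \<Longrightarrow> smooth_on (c ` U) (\<lambda>x. f (inv_into U c x))"
  by (auto simp: smooth_def o_def dest: bspec[of A _ "(U, c)"])

section \<open>Charts, smooth functions and cut-off coordinate fields\<close>

locale atlas_manifold =
  fixes A :: "('m::{t2_space, second_countable_topology}) atlas"
  assumes atlas: "smooth_atlas A"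
begin

lemma chart_open:
  assumes "(U, c) \<in> A"
  shows "open U" "open (c ` U)"
  using atlas assms by (auto simp: smooth_atlas_def dest: bspec[of A _ "(U, c)"])

lemma chart_homeomorphism:
  assumes "(U, c) \<in> A"
  shows "homeomorphism U (c ` U) c (inv_into U c)"
  using atlas assms by (auto simp: smooth_atlas_def dest: bspec[of A _ "(U, c)"])

lemma chart_inverse:
  assumes "(U, c) \<in> A" "p \<in> U"
  shows "inv_into U c (c p) = p"
  using chart_homeomorphism[OF assms(1)] assms(2) by (simp add: homeomorphism_def)

lemma chart_covers: obtains U c where "(U, c) \<in> A" "p \<in> U"
proof -
  have "p \<in> (\<Union>(U, c)\<in>A. U)" using atlas by (simp add: smooth_atlas_def)
  then show ?thesis using that by auto
qed

lemma transition_smooth: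
  assumes "(U, c) \<in> A" "(V, d) \<in> A"
  shows "smooth_on (c ` (U \<inter> V)) (\<lambda>x. d (inv_into U c x))"
proof -
  have "\<forall>(U, c)\<in>A. \<forall>(V, d)\<in>A. smooth_on (c ` (U \<inter> V)) (d \<circ> inv_into U c)"
    using atlas by (simp add: smooth_atlas_def)
  from bspec[OF this assms(1)] have "\<forall>(V, d)\<in>A. smooth_on (c ` (U \<inter> V)) (d \<circ> inv_into U c)"
    by simp
  from bspec[OF this assms(2)] show ?thesis by (simp add: o_def)
qed

lemma chart_open_image:
  assumes "(U, c) \<in> A" "open W" "W \<subseteq> U"
  shows "open (c ` W)"
proof -
  have "c ` W = c ` U \<inter> inv_into U c -` W"
  proof (intro subset_antisym subsetI)
    fix y assume "y \<in> c ` W"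
    then obtain p where "p \<in> W" "y = c p" by blast
    then show "y \<in> c ` U \<inter> inv_into U c -` W"
      using assms(3) chart_inverse[OF assms(1), of p] by auto
  next
    fix y assume y: "y \<in> c ` U \<inter> inv_into U c -` W"
    then obtain p where "p \<in> U" "y = c p" by blast
    then show "y \<in> c ` W"
      using y chart_inverse[OF assms(1), of p] by auto
  qed
  then show ?thesis
    using continuous_open_preimage[OF homeomorphism_cont2[OF chart_homeomorphism[OF assms(1)]]
        chart_open(2)[OF assms(1)] assms(2)] by simp
qed

lemma smoothI: "(\<And>U c k. (U, c) \<in> A \<Longrightarrow> Ck_on k (c ` U) (\<lambda>x. f (inv_into U c x))) \<Longrightarrow> smooth A f"
  by (auto simp: smooth_def smooth_on_def o_def)

lemma smoothD: "smooth A f \<Longrightarrow> (U, c) \<in> A \<Longrightarrow> Ck_on k (c ` U) (\<lambda>x. f (inv_into U c x))"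
  using smooth_on_chart[of A f U c] by (simp add: smooth_on_def)

lemma smooth_const: "smooth A (\<lambda>p. c)"
  by (intro smoothI Ck_on_const chart_open(2))

lemma smooth_add: "smooth A f \<Longrightarrow> smooth A g \<Longrightarrow> smooth A (\<lambda>p. f p + g p)"
  by (rule smoothI, rule Ck_on_add) (assumption | rule chart_open(2) smoothD)+

lemma smooth_scaleR: "smooth A f \<Longrightarrow> smooth A g \<Longrightarrow> smooth A (\<lambda>p. f p *\<^sub>R g p)"
  by (rule smoothI, rule Ck_on_scaleR) (assumption | rule chart_open(2) smoothD)+

lemma smooth_mult:
  fixes f g :: "'m \<Rightarrow> real"
  shows "smooth A f \<Longrightarrow> smooth A g \<Longrightarrow> smooth A (\<lambda>p. f p * g p)"
  using smooth_scaleR[of f g] by simp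

lemma smooth_bounded_linear: "bounded_linear L \<Longrightarrow> smooth A f \<Longrightarrow> smooth A (\<lambda>p. L (f p))"
  by (rule smoothI, rule Ck_on_bounded_linear) (assumption | rule chart_open(2) smoothD)+

text \<open>Two kinds of open sets cover the manifold: on \<open>U\<close> the function is a
  transition map followed by a smooth function, and off the compact preimage of the closed ball it
  is zero.\<close>

lemma smooth_bump_extension:
  fixes G :: "real ^ 3 \<Rightarrow> real"
  assumes U: "(U, c) \<in> A" and G: "smooth_on (c ` U) G"
    and \<epsilon>: "\<epsilon> > 0" and sub: "cball x0 \<epsilon> \<subseteq> c ` U"
  shows "smooth A (\<lambda>p. if p \<in> U then bump x0 \<epsilon> (c p) * G (c p) else 0)"
    (is "smooth A ?F")
proof (rule smoothI)
  fix V d k assume V: "(V, d) \<in> A"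
  define K where "K = inv_into U c ` cball x0 \<epsilon>"
  have "continuous_on (cball x0 \<epsilon>) (inv_into U c)"
    by (rule continuous_on_subset[OF homeomorphism_cont2[OF chart_homeomorphism[OF U]] sub])
  \<comment> \<open>The Hausdorff property enters here: compact sets are closed.\<close>
  then have "closed K"
    unfolding K_def using compact_continuous_image compact_imp_closed compact_cball by metis
  show "Ck_on k (d ` V) (\<lambda>y. ?F (inv_into V d y))"
  proof (rule Ck_on_local)
    fix y assume "y \<in> d ` V"
    then obtain q where q: "q \<in> V" "y = d q" by blast
    show "\<exists>T. open T \<and> y \<in> T \<and> Ck_on k T (\<lambda>y. ?F (inv_into V d y))"
    proof (cases "q \<in> U")
      case True
      let ?T = "d ` (V \<inter> U)"
      have T: "open ?T"
        by (rule chart_open_image[OF V]) (use chart_open(1) U V in auto)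
      have trans: "Ck_on k ?T (\<lambda>y. c (inv_into V d y))"
        using transition_smooth[OF V U] by (simp add: smooth_on_def)
      have im: "c (inv_into V d y) \<in> c ` U" if "y \<in> ?T" for y
        using that chart_inverse[OF V] by auto
      have "Ck_on k (c ` U) (\<lambda>x. bump x0 \<epsilon> x *\<^sub>R G x)"
        using G Ck_on_subset[OF Ck_on_bump]
        by (intro Ck_on_scaleR chart_open(2)[OF U]) (auto simp: smooth_on_def)
      from Ck_on_compose[OF T chart_open(2)[OF U] im trans this]
      have "Ck_on k ?T (\<lambda>y. bump x0 \<epsilon> (c (inv_into V d y)) * G (c (inv_into V d y)))"
        by simp
      then have "Ck_on k ?T (\<lambda>y. ?F (inv_into V d y))"
        by (rule Ck_on_cong[OF T, rotated]) (auto simp: chart_inverse[OF V])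
      with T True q show ?thesis by blast
    next
      case False
      let ?T = "d ` (V - K)"
      have T: "open ?T"
        by (rule chart_open_image[OF V]) (use chart_open(1)[OF V] \<open>closed K\<close> in auto)
      have "bump x0 \<epsilon> (c p) = 0" if "p \<in> U" "p \<notin> K" for p
      proof (rule bump_eq_0[OF \<epsilon>])
        show "c p \<notin> cball x0 \<epsilon>"
          using that chart_inverse[OF U that(1)] unfolding K_def by (metis imageI)
      qed
      then have "Ck_on k ?T (\<lambda>y. ?F (inv_into V d y))"
        by (intro Ck_on_cong[OF T _ Ck_on_const[OF T, of k 0]]) (auto simp: chart_inverse[OF V])
      moreover have "q \<notin> K"
        using False sub inv_into_into[of _ c U] unfolding K_def by blast
      ultimately show ?thesis using T q by blast
    qed
  qed
qed

text \<open>The coordinate derivative in direction \<open>v\<close>, cut off so as to be globally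
  defined. The test \<open>smooth A f\<close> implements the convention that vector fields vanish on
  non-smooth functions.\<close>

definition bump_field :: "'m set \<Rightarrow> ('m \<Rightarrow> real ^ 3) \<Rightarrow> real ^ 3 \<Rightarrow> real \<Rightarrow> real ^ 3 \<Rightarrow> 'm vfield" where
  "bump_field U c x0 \<epsilon> v f p =
     (if smooth A f \<and> p \<in> U
      then bump x0 \<epsilon> (c p) * frechet_derivative (\<lambda>x. f (inv_into U c x)) (at (c p)) v else 0)"

lemma chart_has_derivative:
  assumes "(U, c) \<in> A" "p \<in> U" "smooth A f"
  shows "((\<lambda>x. f (inv_into U c x)) has_derivative
    frechet_derivative (\<lambda>x. f (inv_into U c x)) (at (c p))) (at (c p))"
  using Ck_on_has_derivative[OF chart_open(2)[OF assms(1)] smoothD[OF assms(3,1)]] assms(2) by blast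

text \<open>The cutoff serves to make \<open>?X f\<close> smooth beyond the chart; the algebraic
  identities are the calculus rules for the derivative at \<open>c p\<close>.\<close>

lemma bump_field_in_vfields:
  assumes U: "(U, c) \<in> A" and \<epsilon>: "\<epsilon> > 0" and sub: "cball x0 \<epsilon> \<subseteq> c ` U"
  shows "bump_field U c x0 \<epsilon> v \<in> vfields A"
proof -
  let ?X = "bump_field U c x0 \<epsilon> v"
  note D = chart_has_derivative[OF U]
  have "smooth A (?X f)" if f: "smooth A f" for f
  proof -
    have "smooth_on (c ` U) (\<lambda>x. frechet_derivative (\<lambda>x. f (inv_into U c x)) (at x) v)"
      using smoothD[OF f U, of "Suc _"] by (simp add: smooth_on_def)
    from smooth_bump_extension[OF U this \<epsilon> sub]
    show ?thesis by (simp add: bump_field_def[abs_def] f cong: if_cong)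
  qed
  moreover have "?X f = (\<lambda>p. 0)" if "\<not> smooth A f" for f
    using that by (simp add: bump_field_def fun_eq_iff)
  moreover have "?X (\<lambda>p. f p + g p) = (\<lambda>p. ?X f p + ?X g p)" if "smooth A f" "smooth A g" for f g
  proof
    fix p
    show "?X (\<lambda>p. f p + g p) p = ?X f p + ?X g p"
    proof (cases "p \<in> U")
      case True
      note deriv = frechet_derivative_at[OF has_derivative_add[OF D[OF True that(1)] D[OF True that(2)]], symmetric]
      show ?thesis
        using that True by (simp add: bump_field_def smooth_add deriv distrib_left)
    qed (simp add: bump_field_def)
  qed
  moreover have "?X (\<lambda>p. k * f p) = (\<lambda>p. k * ?X f p)" if "smooth A f" for k f
  proof
    fix p
    show "?X (\<lambda>p. k * f p) p = k * ?X f p"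
    proof (cases "p \<in> U")
      case True
      note deriv = frechet_derivative_at[OF has_derivative_mult_right[OF D[OF True that], of k], symmetric]
      show ?thesis
        using that True by (simp add: bump_field_def smooth_mult smooth_const deriv)
    qed (simp add: bump_field_def)
  qed
  moreover have "?X (\<lambda>p. f p * g p) = (\<lambda>p. ?X f p * g p + f p * ?X g p)"
    if "smooth A f" "smooth A g" for f g
  proof
    fix p
    show "?X (\<lambda>p. f p * g p) p = ?X f p * g p + f p * ?X g p"
    proof (cases "p \<in> U")
      case True
      note deriv = frechet_derivative_at[OF has_derivative_mult[OF D[OF True that(1)] D[OF True that(2)]], symmetric]
      show ?thesis
        using that True
        by (simp add: bump_field_def smooth_mult deriv chart_inverse[OF U] algebra_simps)
    qed (simp add: bump_field_def)
  qed
  ultimately show ?thesis by (simp add: vfields_def)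
qed

text \<open>Near any point the bump factor is positive, so vanishing of all bump fields on
  \<open>f\<close> makes its chart derivative zero on a ball. The ball is convex, hence
  \<open>f\<close> is locally constant, and connectedness does the rest.\<close>

lemma constant_if_vfields_vanish:
  fixes f :: "'m \<Rightarrow> real"
  assumes conn: "connected (UNIV :: 'm set)" and f: "smooth A f"
    and zero: "\<And>X. X \<in> vfields A \<Longrightarrow> X f = (\<lambda>p. 0)"
  shows "f p = f q"
proof (rule connected_local_const[where f = f, OF conn UNIV_I UNIV_I])
  show "\<forall>a\<in>UNIV. eventually (\<lambda>b. f a = f b) (at a within UNIV)"
  proof
    fix p
    obtain U c where U: "(U, c) \<in> A" and p: "p \<in> U" by (rule chart_covers)
    obtain \<epsilon> where \<epsilon>: "\<epsilon> > 0" and sub: "cball (c p) \<epsilon> \<subseteq> c ` U"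
      using chart_open(2)[OF U] p by (meson imageI open_contains_cball_eq)
    let ?f = "\<lambda>x. f (inv_into U c x)"
    have "(?f has_derivative (\<lambda>v. 0)) (at x within ball (c p) \<epsilon>)" if x: "x \<in> ball (c p) \<epsilon>" for x
    proof -
      have "x \<in> c ` U" using x sub ball_subset_cball by blast
      then obtain q where q: "q \<in> U" "x = c q" by blast
      have "frechet_derivative ?f (at x) v = 0" for v
        using fun_cong[OF zero[OF bump_field_in_vfields[OF U \<epsilon> sub, of v]], of q] bump_pos[OF x] f q
        by (simp add: bump_field_def)
      then have "frechet_derivative ?f (at x) = (\<lambda>v. 0)" by (simp add: fun_eq_iff)
      with chart_has_derivative[OF U q(1) f] show ?thesis
        unfolding q(2) by (simp add: has_derivative_at_withinI)
    qed
    then obtain k where k: "\<And>x. x \<in> ball (c p) \<epsilon> \<Longrightarrow> ?f x = k"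
      by (metis has_derivative_zero_constant[OF convex_ball, of "c p" \<epsilon> ?f])
    let ?W = "U \<inter> c -` ball (c p) \<epsilon>"
    have "open ?W"
      by (rule continuous_open_preimage[OF homeomorphism_cont1[OF chart_homeomorphism[OF U]]
            chart_open(1)[OF U] open_ball])
    moreover have "p \<in> ?W" using p \<epsilon> by simp
    moreover have "f b = k" if "b \<in> ?W" for b
      using k[of "c b"] chart_inverse[OF U, of b] that by simp
    ultimately have "\<exists>S. open S \<and> p \<in> S \<and> (\<forall>b\<in>S. b \<noteq> p \<longrightarrow> b \<in> UNIV \<longrightarrow> f p = f b)"
      by (intro exI[of _ ?W]) simp
    then show "eventually (\<lambda>b. f p = f b) (at p within UNIV)"
      by (simp add: eventually_at_topological)
  qed
qed

end

text \<open>A free homotopy between the constant loops at \<open>x\<close> and \<open>y\<close>,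
  restricted to loop parameter 0, is a path from \<open>x\<close> to \<open>y\<close>.\<close>

lemma simply_connected_imp_connected_UNIV:
  assumes "simply_connected (UNIV :: 'm::topological_space set)"
  shows "connected (UNIV :: 'm set)"
proof -
  have "\<exists>g. path g \<and> path_image g \<subseteq> UNIV \<and> pathstart g = x \<and> pathfinish g = y" for x y :: 'm
  proof -
    have "homotopic_loops UNIV (\<lambda>t. x) (\<lambda>t. y)"
      using assms unfolding simply_connected_def
      by (auto simp: path_def pathstart_def pathfinish_def)
    then obtain h :: "real \<times> real \<Rightarrow> 'm" where h: "continuous_on ({0..1} \<times> {0..1}) h"
      "\<forall>t\<in>{0..1}. h (0, t) = x" "\<forall>t\<in>{0..1}. h (1, t) = y"
      unfolding homotopic_loops by metis
    have "path (\<lambda>t. h (t, 0))"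
      unfolding path_def by (rule continuous_on_compose2[OF h(1)]) (auto intro!: continuous_intros)
    then show ?thesis
      using h by (intro exI[of _ "\<lambda>t. h (t, 0)"]) (auto simp: pathstart_def pathfinish_def)
  qed
  then show ?thesis
    by (intro path_connected_imp_connected) (auto simp: path_connected_def)
qed

section \<open>Vector fields and curvature as tensors\<close>

context atlas_manifold begin

lemma vf_smooth: "X \<in> vfields A \<Longrightarrow> smooth A (X f)"
  using smooth_const[of "0::real"] by (cases "smooth A f") (auto simp: vfields_def)

lemma vf_add:
  "X \<in> vfields A \<Longrightarrow> smooth A f \<Longrightarrow> smooth A g \<Longrightarrow> X (\<lambda>p. f p + g p) = (\<lambda>p. X f p + X g p)"
  by (simp add: vfields_def)

lemma vf_cmult:
  "X \<in> vfields A \<Longrightarrow> smooth A f \<Longrightarrow> X (\<lambda>p. c * f p) = (\<lambda>p. c * X f p)"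
  by (simp add: vfields_def)

lemma vf_mult:
  "X \<in> vfields A \<Longrightarrow> smooth A f \<Longrightarrow> smooth A g \<Longrightarrow> X (\<lambda>p. f p * g p) = (\<lambda>p. X f p * g p + f p * X g p)"
  by (simp add: vfields_def)

lemma vf_nonsmooth: "X \<in> vfields A \<Longrightarrow> \<not> smooth A f \<Longrightarrow> X f = (\<lambda>p. 0)"
  by (simp add: vfields_def)

text \<open>The Leibniz rule for 1 = 1 * 1 gives \<open>X 1 = 2 * X 1\<close>.\<close>

lemma vf_const:
  assumes X: "X \<in> vfields A"
  shows "X (\<lambda>p. c) = (\<lambda>p. 0)"
proof -
  have "X (\<lambda>p. 1) = (\<lambda>p. 0)"
    using vf_mult[OF X smooth_const smooth_const, of 1 1] by (simp add: fun_eq_iff)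
  then show ?thesis
    using vf_cmult[OF X smooth_const, of c 1] by simp
qed

lemma smooth_diff:
  fixes f g :: "'m \<Rightarrow> real"
  shows "smooth A f \<Longrightarrow> smooth A g \<Longrightarrow> smooth A (\<lambda>p. f p - g p)"
  using smooth_add[of f "\<lambda>p. - 1 * g p"] smooth_mult[OF smooth_const, of g "-1"] by simp

lemma vadd_in: "X \<in> vfields A \<Longrightarrow> Y \<in> vfields A \<Longrightarrow> vadd X Y \<in> vfields A"
  by (simp add: vfields_def vadd_def smooth_add algebra_simps)

lemma vscale_in: "smooth A u \<Longrightarrow> X \<in> vfields A \<Longrightarrow> vscale u X \<in> vfields A"
  by (simp add: vfields_def vscale_def smooth_mult algebra_simps)

lemma vdiff_eq: "vdiff X Y = vadd X (vscale (\<lambda>p. -1) Y)"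
  by (simp add: vdiff_def vadd_def vscale_def)

lemma vdiff_in: "X \<in> vfields A \<Longrightarrow> Y \<in> vfields A \<Longrightarrow> vdiff X Y \<in> vfields A"
  by (simp add: vdiff_eq vadd_in vscale_in smooth_const)

text \<open>In the Leibniz rule the mixed first-order products are symmetric in \<open>X\<close> and
  \<open>Y\<close> and cancel. On a non-smooth function the inner field returns the zero function,
  which the outer field kills by \<open>vf_const\<close>.\<close>

lemma lie_bracket_in:
  assumes "X \<in> vfields A" "Y \<in> vfields A"
  shows "lie_bracket X Y \<in> vfields A"
proof -
  note s = vf_smooth[OF assms(1)] vf_smooth[OF assms(2)]
  note a = vf_add[OF assms(1)] vf_add[OF assms(2)]
  note m = vf_mult[OF assms(1)] vf_mult[OF assms(2)]
  note c = vf_cmult[OF assms(1)] vf_cmult[OF assms(2)]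
  note n = vf_nonsmooth[OF assms(1)] vf_nonsmooth[OF assms(2)]
    vf_const[OF assms(1)] vf_const[OF assms(2)]
  show ?thesis
    unfolding vfields_def lie_bracket_def
    by (simp add: s a m c n smooth_diff smooth_mult algebra_simps)
qed

lemma lie_bracket_vadd:
  assumes "X \<in> vfields A" "Y \<in> vfields A" "Z \<in> vfields A"
  shows "lie_bracket X (vadd Y Z) = vadd (lie_bracket X Y) (lie_bracket X Z)"
  using assms by (simp add: lie_bracket_def vadd_def fun_eq_iff vf_add vf_smooth)

lemma lie_bracket_vscale:
  assumes "X \<in> vfields A" "Y \<in> vfields A" "smooth A u"
  shows "lie_bracket X (vscale u Y) = vadd (vscale (X u) Y) (vscale u (lie_bracket X Y))"
  using assms by (simp add: lie_bracket_def vadd_def vscale_def fun_eq_iff vf_mult vf_smooth algebra_simps)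

lemma lie_bracket_self: "lie_bracket X X = (\<lambda>f p. 0)"
  by (simp add: lie_bracket_def)

lemma lie_bracket_swap: "lie_bracket Y X = vscale (\<lambda>p. -1) (lie_bracket X Y)"
  by (simp add: lie_bracket_def vscale_def)

end

lemma vscale_zero: "vscale (\<lambda>p. 0) X = (\<lambda>f p. 0)" "vscale u (\<lambda>f p. 0) = (\<lambda>f p. 0)"
  by (simp_all add: vscale_def)

lemma vscale_vscale: "vscale u (vscale v X) = vscale (\<lambda>p. u p * v p) X"
  by (simp add: vscale_def mult.assoc)

locale affine_manifold = atlas_manifold A
  for A :: "('m::{t2_space, second_countable_topology}) atlas" +
  fixes nabla :: "'m connection"
  assumes conn: "affine_connection A nabla"
begin

lemma nabla_in: "X \<in> vfields A \<Longrightarrow> Y \<in> vfields A \<Longrightarrow> nabla X Y \<in> vfields A"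
  using conn by (simp add: affine_connection_def)

lemma nabla_add:
  assumes "X \<in> vfields A" "Y \<in> vfields A" "Z \<in> vfields A"
  shows "nabla (vadd X Y) Z = vadd (nabla X Z) (nabla Y Z)"
    "nabla X (vadd Y Z) = vadd (nabla X Y) (nabla X Z)"
  using conn assms by (auto simp: affine_connection_def)

lemma nabla_scale:
  assumes "X \<in> vfields A" "Y \<in> vfields A" "smooth A u"
  shows "nabla (vscale u X) Y = vscale u (nabla X Y)"
    "nabla X (vscale u Y) = vadd (vscale (X u) Y) (vscale u (nabla X Y))"
  using conn assms by (auto simp: affine_connection_def)

lemma nabla_cscale:
  assumes "X \<in> vfields A" "Y \<in> vfields A"
  shows "nabla X (vscale (\<lambda>p. c) Y) = vscale (\<lambda>p. c) (nabla X Y)"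
  using nabla_scale(2)[OF assms smooth_const, of c] vf_const[OF assms(1)]
  by (simp add: vadd_def vscale_def)

lemma nabla_zero:
  assumes "X \<in> vfields A"
  shows "nabla X (\<lambda>f p. 0) = (\<lambda>f p. 0)" "nabla (\<lambda>f p. 0) X = (\<lambda>f p. 0)"
  using nabla_scale(1)[OF assms assms smooth_const, of 0] nabla_cscale[OF assms assms, of 0]
  by (simp_all add: vscale_zero)

lemmas vf_closed = nabla_in vadd_in vscale_in vdiff_in lie_bracket_in vf_smooth

lemma curvature_in:
  "X \<in> vfields A \<Longrightarrow> Y \<in> vfields A \<Longrightarrow> Z \<in> vfields A \<Longrightarrow> curvature nabla X Y Z \<in> vfields A"
  by (simp add: curvature_def vf_closed)

lemma curvature_vadd:
  assumes "X \<in> vfields A" "Y \<in> vfields A" "Z \<in> vfields A" "W \<in> vfields A"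
  shows "curvature nabla X (vadd Y W) Z = vadd (curvature nabla X Y Z) (curvature nabla X W Z)"
    "curvature nabla X Y (vadd Z W) = vadd (curvature nabla X Y Z) (curvature nabla X Y W)"
  using assms
  by (simp_all add: curvature_def nabla_add vf_closed lie_bracket_vadd)
    (simp_all add: vadd_def vdiff_def fun_eq_iff)

text \<open>The terms that differentiate \<open>u\<close> cancel: in the second slot against the
  correction in \<open>lie_bracket X (vscale u Y)\<close>, in the third against the derivative of
  \<open>u\<close> along the bracket. These are the two slots in which \<open>ricci\<close> has free
  arguments.\<close>

lemma curvature_vscale:
  assumes "X \<in> vfields A" "Y \<in> vfields A" "Z \<in> vfields A" "smooth A u"
  shows "curvature nabla X (vscale u Y) Z = vscale u (curvature nabla X Y Z)"
    "curvature nabla X Y (vscale u Z) = vscale u (curvature nabla X Y Z)"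
  using assms
  by (simp_all add: curvature_def nabla_add nabla_scale vf_closed lie_bracket_vscale)
    (simp_all add: vadd_def vdiff_def vscale_def lie_bracket_def fun_eq_iff algebra_simps)

end

section \<open>The Levi-Civita connection of a Sasakian frame\<close>

lemma coframe_eq: "coframe r g e j X = (\<lambda>p. hdiag r j * g (e j) X p)"
  by (simp add: coframe_def fun_eq_iff)

lemma hdiag_sq: "hdiag r j * hdiag r j = 1"
  by (simp add: hdiag_def flip: power_mult_distrib)

text \<open>Positivity of the metric fails for \<open>r = 1\<close>, so tensoriality and symmetry
  are assumed directly; nondegeneracy comes from the orthonormal frame.\<close>

locale sasakian_framed = affine_manifold A nabla
  for A :: "('m::{t2_space, second_countable_topology}) atlas" and nabla +
  fixes r :: nat and H :: real and \<xi> :: "'m vfield" and g :: "'m metric" and e :: "3 \<Rightarrow> 'm vfield"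
  assumes metric_form: "X \<in> vfields A \<Longrightarrow> one_form A (g X)"
    and metric_sym: "X \<in> vfields A \<Longrightarrow> Y \<in> vfields A \<Longrightarrow> g X Y = g Y X"
    and sframe: "sasakian_frame r H A \<xi> g e"
    and lc: "levi_civita A g nabla"
begin

abbreviation "eps \<equiv> (-1) ^ r :: real"

lemma eps_sq: "eps * eps = 1"
  by (simp flip: power_mult_distrib)

lemma metric_smooth: "X \<in> vfields A \<Longrightarrow> Y \<in> vfields A \<Longrightarrow> smooth A (g X Y)"
  using metric_form by (simp add: one_form_def)

lemma metric_vadd:
  assumes "X \<in> vfields A" "Y \<in> vfields A" "Z \<in> vfields A"
  shows "g Z (vadd X Y) = (\<lambda>p. g Z X p + g Z Y p)" "g (vadd X Y) Z = (\<lambda>p. g X Z p + g Y Z p)"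
proof -
  show *: "g Z (vadd X Y) = (\<lambda>p. g Z X p + g Z Y p)"
    using metric_form[OF assms(3)] assms by (simp add: one_form_def)
  show "g (vadd X Y) Z = (\<lambda>p. g X Z p + g Y Z p)"
    using * metric_sym[OF vadd_in[OF assms(1,2)] assms(3)] metric_sym[OF assms(1,3)] metric_sym[OF assms(2,3)]
    by metis
qed

lemma metric_vscale:
  assumes "X \<in> vfields A" "Z \<in> vfields A" "smooth A u"
  shows "g Z (vscale u X) = (\<lambda>p. u p * g Z X p)" "g (vscale u X) Z = (\<lambda>p. u p * g X Z p)"
proof -
  show *: "g Z (vscale u X) = (\<lambda>p. u p * g Z X p)"
    using metric_form[OF assms(2)] assms by (simp add: one_form_def)
  show "g (vscale u X) Z = (\<lambda>p. u p * g X Z p)"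
    using * metric_sym[OF vscale_in[OF assms(3,1)] assms(2)] metric_sym[OF assms(1,2)]
    by metis
qed

lemma metric_vdiff:
  assumes "X \<in> vfields A" "Y \<in> vfields A" "Z \<in> vfields A"
  shows "g Z (vdiff X Y) = (\<lambda>p. g Z X p - g Z Y p)" "g (vdiff X Y) Z = (\<lambda>p. g X Z p - g Y Z p)"
  using assms by (simp_all add: vdiff_eq metric_vadd metric_vscale vscale_in smooth_const)

lemma metric_zero:
  assumes "Z \<in> vfields A"
  shows "g Z (\<lambda>f p. 0) = (\<lambda>p. 0)" "g (\<lambda>f p. 0) Z = (\<lambda>p. 0)"
  using metric_vscale[OF assms assms smooth_const, of 0] by (simp_all add: vscale_zero)

lemma frame_in: "e j \<in> vfields A"
  using sframe by (simp add: sasakian_frame_def frame_def)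

lemma frame_metric: "g (e i) (e j) = (\<lambda>p. if i = j then hdiag r i else 0)"
  using sframe by (simp add: sasakian_frame_def)

lemma frame_1: "e 1 = \<xi>"
  using sframe by (simp add: sasakian_frame_def)

lemma frame_bracket:
  "lie_bracket (e 1) (e 2) = vscale (\<lambda>p. - (H + eps * 3) / 2) (e 3)"
  "lie_bracket (e 1) (e 3) = vscale (\<lambda>p. (H + eps * 3) / 2) (e 2)"
  "lie_bracket (e 2) (e 3) = vscale (\<lambda>p. - 2) (e 1)"
  using sframe unfolding sasakian_frame_def by blast+

lemma coframe_smooth: "X \<in> vfields A \<Longrightarrow> smooth A (coframe r g e j X)"
  by (simp add: coframe_eq smooth_mult smooth_const metric_smooth frame_in)

lemma coframe_frame: "coframe r g e j (e k) p = (if j = k then 1 else 0)"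
  by (simp add: coframe_def frame_metric hdiag_sq)

text \<open>The frame property provides smooth coefficients; pairing with each \<open>e j\<close>
  identifies them as coframe values.\<close>

lemma frame_expansion:
  assumes X: "X \<in> vfields A"
  shows "X = vadd (vadd (vscale (coframe r g e 1 X) (e 1)) (vscale (coframe r g e 2 X) (e 2)))
    (vscale (coframe r g e 3 X) (e 3))"
proof -
  obtain u where u: "\<And>j. smooth A (u j)" "X = (\<lambda>f p. \<Sum>j\<in>UNIV. u j p * e j f p)"
  proof -
    have "\<exists>!u :: 3 \<Rightarrow> 'm \<Rightarrow> real. (\<forall>j. smooth A (u j)) \<and> X = (\<lambda>f p. \<Sum>j\<in>UNIV. u j p * e j f p)"
      using sframe X by (simp add: sasakian_frame_def frame_def)
    from ex1_implies_ex[OF this] show ?thesis using that by blast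
  qed
  then have eq: "X = vadd (vadd (vscale (u 1) (e 1)) (vscale (u 2) (e 2))) (vscale (u 3) (e 3))"
    by (simp add: vadd_def vscale_def sum_3)
  have "coframe r g e j X p = u j p" for j p
  proof -
    have "g (e j) X p = u 1 p * g (e j) (e 1) p + u 2 p * g (e j) (e 2) p + u 3 p * g (e j) (e 3) p"
      by (simp add: eq metric_vadd metric_vscale vscale_in vadd_in frame_in u(1))
    then have "coframe r g e j X p = u 1 p * coframe r g e j (e 1) p + u 2 p * coframe r g e j (e 2) p
        + u 3 p * coframe r g e j (e 3) p"
      by (simp add: coframe_def algebra_simps)
    then show ?thesis
      unfolding coframe_frame using exhaust_3[of j] by auto
  qed
  then have "coframe r g e j X = u j" for j by (simp add: fun_eq_iff)
  with eq show ?thesis by simp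
qed

lemma metric_expansion:
  assumes X: "X \<in> vfields A" and Y: "Y \<in> vfields A"
  shows "g X Y p = (\<Sum>j\<in>UNIV. hdiag r j * coframe r g e j X p * coframe r g e j Y p)"
proof -
  have h: "g (e j) Z p = hdiag r j * coframe r g e j Z p" for j Z
    by (simp add: coframe_def mult.assoc[symmetric] hdiag_sq)
  show ?thesis
    by (subst (1) frame_expansion[OF X])
      (simp add: metric_vadd metric_vscale vscale_in vadd_in frame_in coframe_smooth X Y h sum_3)
qed

text \<open>Koszul's formula without derivative terms, since the products
  \<open>g (e i) (e j)\<close> are constant. It results from three cyclic instances of metric
  compatibility with torsion-freeness.\<close>

lemma nabla_frame_metric:
  "g (nabla (e i) (e j)) (e k) p =
    (g (lie_bracket (e i) (e j)) (e k) p - g (lie_bracket (e j) (e k)) (e i) p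
      + g (lie_bracket (e k) (e i)) (e j) p) / 2"
proof -
  have compat: "g (nabla (e i) (e j)) (e k) p + g (nabla (e i) (e k)) (e j) p = 0" for i j k
  proof -
    have "(e i) (g (e j) (e k)) = (\<lambda>p. g (nabla (e i) (e j)) (e k) p + g (e j) (nabla (e i) (e k)) p)"
      using lc frame_in by (simp add: levi_civita_def)
    moreover have "(e i) (g (e j) (e k)) p = 0"
      using vf_const[OF frame_in] by (simp add: frame_metric fun_eq_iff)
    ultimately show ?thesis
      using metric_sym[OF frame_in nabla_in[OF frame_in frame_in], of j i k] by (simp add: fun_eq_iff)
  qed
  have torsion: "g (lie_bracket (e i) (e j)) (e k) p = g (nabla (e i) (e j)) (e k) p - g (nabla (e j) (e i)) (e k) p"
    for i j k
  proof -
    have "lie_bracket (e i) (e j) = vdiff (nabla (e i) (e j)) (nabla (e j) (e i))"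
      using lc frame_in by (simp add: levi_civita_def)
    then show ?thesis
      by (simp add: metric_vdiff nabla_in frame_in)
  qed
  show ?thesis
    using compat[of i j k] compat[of j k i] compat[of k i j] 
    unfolding torsion by (simp add: field_simps)
qed

lemma frame_bracket_metric:
  "g (lie_bracket (e 1) (e 2)) (e k) p = (if k = 3 then - (H + eps * 3) / 2 else 0)"
  "g (lie_bracket (e 2) (e 1)) (e k) p = (if k = 3 then (H + eps * 3) / 2 else 0)"
  "g (lie_bracket (e 1) (e 3)) (e k) p = (if k = 2 then (H + eps * 3) / 2 else 0)"
  "g (lie_bracket (e 3) (e 1)) (e k) p = (if k = 2 then - (H + eps * 3) / 2 else 0)"
  "g (lie_bracket (e 2) (e 3)) (e k) p = (if k = 1 then - 2 * eps else 0)"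
  "g (lie_bracket (e 3) (e 2)) (e k) p = (if k = 1 then 2 * eps else 0)"
  "g (lie_bracket (e j) (e j)) (e k) p = 0"
  by (auto simp: frame_bracket lie_bracket_swap[of "e 2" "e 1"] lie_bracket_swap[of "e 3" "e 1"]
      lie_bracket_swap[of "e 3" "e 2"] lie_bracket_self metric_vscale vscale_in smooth_const frame_in
      frame_metric hdiag_def metric_zero field_simps)

lemma nabla_frame_expansion:
  "nabla (e i) (e j) = (\<lambda>f p. \<Sum>k\<in>UNIV. hdiag r k *
    ((g (lie_bracket (e i) (e j)) (e k) p - g (lie_bracket (e j) (e k)) (e i) p
      + g (lie_bracket (e k) (e i)) (e j) p) / 2) * e k f p)"
proof -
  have "nabla (e i) (e j) = (\<lambda>f p. \<Sum>k\<in>UNIV. hdiag r k * g (nabla (e i) (e j)) (e k) p * e k f p)"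
    by (subst (1) frame_expansion[OF nabla_in[OF frame_in frame_in]])
      (simp add: vadd_def vscale_def coframe_def sum_3 metric_sym[OF frame_in nabla_in[OF frame_in frame_in]])
  then show ?thesis by (simp add: nabla_frame_metric)
qed

lemma nabla_frame:
  "nabla (e 1) (e 2) = vscale (\<lambda>p. - (H + eps) / 2) (e 3)"
  "nabla (e 1) (e 3) = vscale (\<lambda>p. (H + eps) / 2) (e 2)"
  "nabla (e 2) (e 1) = vscale (\<lambda>p. eps) (e 3)"
  "nabla (e 3) (e 1) = vscale (\<lambda>p. - eps) (e 2)"
  "nabla (e 2) (e 3) = vscale (\<lambda>p. - 1) (e 1)"
  "nabla (e 3) (e 2) = vscale (\<lambda>p. 1) (e 1)"
  "nabla (e j) (e j) = (\<lambda>f p. 0)"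
  using exhaust_3[of j]
  by (auto simp: nabla_frame_expansion frame_bracket_metric sum_3 hdiag_def vscale_def fun_eq_iff
      field_simps eps_sq)

end

section \<open>Ricci curvature\<close>

context sasakian_framed begin

lemma frame_bracket_swapped:
  "lie_bracket (e 2) (e 1) = vscale (\<lambda>p. (H + eps * 3) / 2) (e 3)"
  "lie_bracket (e 3) (e 1) = vscale (\<lambda>p. - (H + eps * 3) / 2) (e 2)"
  "lie_bracket (e 3) (e 2) = vscale (\<lambda>p. 2) (e 1)"
  by (simp_all add: lie_bracket_swap[of "e 2" "e 1"] lie_bracket_swap[of "e 3" "e 1"]
      lie_bracket_swap[of "e 3" "e 2"] frame_bracket vscale_vscale field_simps)

lemma vdiff_vscale_const: "vdiff (vscale (\<lambda>p. x) X) (vscale (\<lambda>p. y) X) = vscale (\<lambda>p. x - y) X"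
  by (simp add: vdiff_def vscale_def algebra_simps)

lemma vdiff_zero: "vdiff X (\<lambda>f p. 0) = X" "vdiff (\<lambda>f p. 0) X = vscale (\<lambda>p. - 1) X"
  by (simp_all add: vdiff_def vscale_def)

lemmas curvature_simps = curvature_def nabla_frame nabla_cscale nabla_scale(1) smooth_const frame_in
  vscale_in nabla_zero vscale_vscale vscale_zero vdiff_vscale_const vdiff_zero frame_bracket
  frame_bracket_swapped lie_bracket_self

text \<open>This is the Sasakian identity R(X,\<xi>)\<xi> = X for X orthogonal to \<xi>.\<close>

lemma curvature_frame_1:
  "curvature nabla (e 2) (e 1) (e 1) = vscale (\<lambda>p. 1) (e 2)"
  "curvature nabla (e 3) (e 1) (e 1) = vscale (\<lambda>p. 1) (e 3)"
  using eps_sq by (simp_all add: curvature_simps field_simps)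

text \<open>The second equation shows that the \<open>H\<close> in the bracket relations is the
  sectional curvature of the contact plane.\<close>

lemma curvature_frame_2:
  "curvature nabla (e 1) (e 2) (e 2) = vscale (\<lambda>p. eps) (e 1)"
  "curvature nabla (e 3) (e 2) (e 2) = vscale (\<lambda>p. H) (e 3)"
  by (simp_all add: curvature_simps field_simps)

lemma curvature_frame_3:
  "curvature nabla (e 1) (e 3) (e 3) = vscale (\<lambda>p. eps) (e 1)"
  "curvature nabla (e 2) (e 3) (e 3) = vscale (\<lambda>p. H) (e 2)"
  by (simp_all add: curvature_simps field_simps)

lemma curvature_frame_mixed:
  "curvature nabla (e 1) (e 2) (e 3) = (\<lambda>f p. 0)"
  "curvature nabla (e 1) (e 3) (e 2) = (\<lambda>f p. 0)"
  "curvature nabla (e 2) (e 1) (e 3) = (\<lambda>f p. 0)"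
  "curvature nabla (e 2) (e 3) (e 1) = (\<lambda>f p. 0)"
  "curvature nabla (e 3) (e 1) (e 2) = (\<lambda>f p. 0)"
  "curvature nabla (e 3) (e 2) (e 1) = (\<lambda>f p. 0)"
  by (simp_all add: curvature_simps field_simps)

lemma curvature_self: "Z \<in> vfields A \<Longrightarrow> curvature nabla X X Z = (\<lambda>f p. 0)"
  by (simp add: curvature_def lie_bracket_self vdiff_def nabla_zero)

lemma curvature_frame_antisym:
  "curvature nabla (e 2) (e 1) (e 2) = vscale (\<lambda>p. - eps) (e 1)"
  "curvature nabla (e 3) (e 1) (e 3) = vscale (\<lambda>p. - eps) (e 1)"
  "curvature nabla (e 1) (e 2) (e 1) = vscale (\<lambda>p. - 1) (e 2)"
  "curvature nabla (e 1) (e 3) (e 1) = vscale (\<lambda>p. - 1) (e 3)"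
  "curvature nabla (e 2) (e 3) (e 2) = vscale (\<lambda>p. - H) (e 3)"
  "curvature nabla (e 3) (e 2) (e 3) = vscale (\<lambda>p. - H) (e 2)"
  using eps_sq by (simp_all add: curvature_simps field_simps)

lemma ricci_frame:
  "ricci r g e nabla (e i) (e j) p = (if i = j then if i = 1 then 2 else H + eps else 0)"
  using exhaust_3[of i] exhaust_3[of j]
  by (auto simp: ricci_def sum_3 curvature_frame_1 curvature_frame_2 curvature_frame_3 curvature_frame_antisym
      curvature_frame_mixed curvature_self coframe_eq metric_vscale metric_zero nabla_zero smooth_const
      frame_in frame_metric hdiag_sq hdiag_def)

lemma scalar_curvature_eq: "scalar_curvature r g e nabla p = 2 * H + 4 * eps"
  by (simp add: scalar_curvature_def metric_trace_def sum_3 ricci_frame hdiag_def)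

lemma ricci_vadd:
  assumes "X \<in> vfields A" "Y \<in> vfields A" "Z \<in> vfields A"
  shows "ricci r g e nabla (vadd X Y) Z p = ricci r g e nabla X Z p + ricci r g e nabla Y Z p"
    "ricci r g e nabla Z (vadd X Y) p = ricci r g e nabla Z X p + ricci r g e nabla Z Y p"
  using assms by (simp_all add: ricci_def curvature_vadd curvature_in coframe_eq metric_vadd frame_in
      sum.distrib distrib_left)

lemma ricci_vscale:
  assumes "X \<in> vfields A" "Z \<in> vfields A" "smooth A u"
  shows "ricci r g e nabla (vscale u X) Z p = u p * ricci r g e nabla X Z p"
    "ricci r g e nabla Z (vscale u X) p = u p * ricci r g e nabla Z X p"
  using assms by (simp_all add: ricci_def curvature_vscale curvature_in coframe_eq metric_vscale frame_in
      sum_distrib_left mult.left_commute)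

lemma ricci_eq:
  assumes X: "X \<in> vfields A" and Y: "Y \<in> vfields A"
  shows "ricci r g e nabla X Y p =
    (H + eps) * g X Y p + (1 - eps * H) * coframe r g e 1 X p * coframe r g e 1 Y p"
proof -
  have "ricci r g e nabla X Y p = 2 * coframe r g e 1 X p * coframe r g e 1 Y p
     + (H + eps) * coframe r g e 2 X p * coframe r g e 2 Y p
     + (H + eps) * coframe r g e 3 X p * coframe r g e 3 Y p"
    by (subst frame_expansion[OF X], subst frame_expansion[OF Y])
      (simp add: ricci_vadd ricci_vscale vadd_in vscale_in frame_in coframe_smooth X Y ricci_frame algebra_simps)
  \<comment> \<open>On the \<open>e 1\<close> component, \<open>eps * eps = 1\<close> gives
    \<open>2 = (H + eps) * eps + (1 - eps * H)\<close>.\<close>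
  then show ?thesis
    using eps_sq by (simp add: metric_expansion[OF X Y] sum_3 hdiag_def algebra_simps)
qed

end

section \<open>Spinor algebra\<close>

text \<open>Clifford multiplication depends only on frame coefficients. Detaching it from vector
  fields lets the connection form and the SqK equation be written with the same pointwise
  operator.\<close>

definition clifford_vec :: "nat \<Rightarrow> (3 \<Rightarrow> real) \<Rightarrow> complex ^ 2 \<Rightarrow> complex ^ 2" where
  "clifford_vec r x v = (\<Sum>j\<in>UNIV. complex_of_real (x j) *s (gam r j *v v))"

lemma clifford_eq: "clifford r g e X \<psi> p = clifford_vec r (\<lambda>j. coframe r g e j X p) (\<psi> p)"
  by (simp add: clifford_def clifford_vec_def)

lemma vec2_eq_iff: "v = w \<longleftrightarrow> v $ 1 = w $ 1 \<and> v $ 2 = w $ 2" for v w :: "'a ^ 2"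
  by (simp add: vec_eq_iff forall_2)

lemma gam_mult:
  assumes "r \<in> {0, 1}"
  shows "(gam r 1 *v v) $ 1 = (if r = 0 then \<i> else 1) * v $ 2"
    "(gam r 1 *v v) $ 2 = (if r = 0 then \<i> else 1) * v $ 1"
    "(gam r 2 *v v) $ 1 = v $ 2"
    "(gam r 2 *v v) $ 2 = - v $ 1"
    "(gam r 3 *v v) $ 1 = \<i> * v $ 1"
    "(gam r 3 *v v) $ 2 = - \<i> * v $ 2"
  using assms
  by (auto simp: gam_def cscale_def pauli1_def pauli2_def pauli3_def map_matrix_def matrix_vector_mult_def
      sum_2 power_int_minus)

lemma clifford_vec_nth:
  assumes "r \<in> {0, 1}"
  shows "clifford_vec r x v $ 1 = (if r = 0 then \<i> else 1) * x 1 * v $ 2 + x 2 * v $ 2 + \<i> * x 3 * v $ 1"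
    "clifford_vec r x v $ 2 = (if r = 0 then \<i> else 1) * x 1 * v $ 1 - x 2 * v $ 1 - \<i> * x 3 * v $ 2"
  by (simp_all add: clifford_vec_def sum_3 gam_mult[OF assms] mult_ac)

lemma spin_form_eq:
  assumes "r \<in> {0, 1}"
  shows "spin_form r v w = (if r = 0 then cnj (v $ 1) * w $ 1 + cnj (v $ 2) * w $ 2
    else cnj (v $ 1) * w $ 2 + cnj (v $ 2) * w $ 1)"
  using assms by (auto simp: spin_form_def sum_2 gam_mult)

lemma spin_form_real: "r \<in> {0, 1} \<Longrightarrow> Im (spin_form r v v) = 0"
  by (simp add: spin_form_eq)

text \<open>\<open>\<i> ^ r\<close> times a real Clifford vector is skew-adjoint for the spin form,
  so its expectation value is imaginary.\<close>

lemma Re_spin_form_clifford: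
  assumes "r \<in> {0, 1}"
  shows "Re (spin_form r v (\<i> ^ r *s clifford_vec r x v)) = 0"
  using assms by (auto simp: spin_form_eq clifford_vec_nth algebra_simps)

text \<open>The symmetric part of the product is a scalar by the Clifford relation, with sign
  \<open>(-1) ^ r\<close> from the two factors \<open>\<i> ^ r\<close>. The commutator of two skew
  operators is skew and has imaginary expectation.\<close>

lemma Re_spin_form_clifford_clifford:
  assumes "r \<in> {0, 1}"
  shows "Re (spin_form r v (\<i> ^ r *s clifford_vec r x (\<i> ^ r *s clifford_vec r y v))) =
    - ((-1) ^ r * (\<Sum>j\<in>UNIV. hdiag r j * x j * y j) * Re (spin_form r v v))"
  using assms by (auto simp: spin_form_eq clifford_vec_nth sum_3 hdiag_def algebra_simps)

lemma spin_form_add: "r \<in> {0, 1} \<Longrightarrow> spin_form r u (v + w) = spin_form r u v + spin_form r u w"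
  by (simp add: spin_form_eq algebra_simps)

lemma spin_form_scale:
  "r \<in> {0, 1} \<Longrightarrow> spin_form r (complex_of_real c *s v) (complex_of_real c *s v) = c\<^sup>2 * spin_form r v v"
  by (simp add: spin_form_eq algebra_simps power2_eq_square)

lemma cscale_mult: "cscale c M *v v = c *s (M *v v)"
  by (simp add: cscale_def map_matrix_def matrix_vector_mult_def vec_eq_iff sum_distrib_left mult.assoc)

text \<open>Uses \<open>(- \<i>) ^ r = \<i> ^ r * (-1) ^ r\<close> and
  \<open>(-1) powi (int r - 1) = - ((-1) ^ r)\<close>. In this form the connection form is visibly
  skew.\<close>

lemma omegaS_mult:
  assumes "r \<in> {0, 1}"
  shows "omegaS r H g e X p *v v = \<i> ^ r *s clifford_vec r
    (\<lambda>j. (-1) ^ r / 2 * coframe r g e j X p + (if j = 1 then (H - (-1) ^ r) / 4 * coframe r g e 1 X p else 0)) v"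
  using assms
  by (auto simp: omegaS_def clifford_vec_def sum_3 matrix_vector_mult_add_rdistrib cscale_mult vec_eq_iff algebra_simps
     add_divide_distrib diff_divide_distrib)

context sasakian_framed begin

lemma smooth_component:
  assumes "smooth A \<psi>"
  shows "smooth A (\<lambda>p. Re ((\<psi> p :: complex ^ 2) $ k))" "smooth A (\<lambda>p. Im (\<psi> p $ k))"
  using smooth_bounded_linear[OF bounded_linear_compose[OF bounded_linear_Re bounded_linear_vec_nth] assms]
    smooth_bounded_linear[OF bounded_linear_compose[OF bounded_linear_Im bounded_linear_vec_nth] assms]
  by auto

lemma spinor_deriv_scale:
  assumes X: "X \<in> vfields A" and \<psi>: "smooth A \<psi>"
  shows "spinor_deriv X (\<lambda>p. complex_of_real c *s \<psi> p) p = complex_of_real c *s spinor_deriv X \<psi> p"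
  by (simp add: spinor_deriv_def vec_eq_iff complex_eq_iff vf_cmult[OF X smooth_component(1)[OF \<psi>]]
      vf_cmult[OF X smooth_component(2)[OF \<psi>]])

lemma smooth_scale:
  assumes "smooth A (\<psi> :: 'm spinor)"
  shows "smooth A (\<lambda>p. complex_of_real c *s \<psi> p)"
proof -
  have "complex_of_real c *s v = c *\<^sub>R v" for v :: "complex ^ 2"
    by (simp add: vec_eq_iff scaleR_conv_of_real[where 'a = complex])
  then show ?thesis
    using smooth_scaleR[OF smooth_const assms, of c] by simp
qed

text \<open>The form is Hermitian with constant coefficients, so the two Leibniz terms are
  conjugate.\<close>

lemma Re_spin_form_deriv:
  assumes X: "X \<in> vfields A" and \<psi>: "smooth A \<psi>" and r: "r \<in> {0, 1}"
  shows "smooth A (\<lambda>p. Re (spin_form r (\<psi> p) (\<psi> p)))"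
    "X (\<lambda>p. Re (spin_form r (\<psi> p) (\<psi> p))) p = 2 * Re (spin_form r (\<psi> p) (spinor_deriv X \<psi> p))"
proof -
  note s = smooth_component[OF \<psi>]
  note rules = smooth_add smooth_mult smooth_const s vf_add[OF X] vf_mult[OF X] vf_const[OF X]
  consider "r = 0" | "r = 1" using r by blast
  then have "smooth A (\<lambda>p. Re (spin_form r (\<psi> p) (\<psi> p))) \<and>
    X (\<lambda>p. Re (spin_form r (\<psi> p) (\<psi> p))) p = 2 * Re (spin_form r (\<psi> p) (spinor_deriv X \<psi> p))"
    by cases (simp_all add: spin_form_eq spinor_deriv_def rules algebra_simps)
  then show "smooth A (\<lambda>p. Re (spin_form r (\<psi> p) (\<psi> p)))"
    "X (\<lambda>p. Re (spin_form r (\<psi> p) (\<psi> p))) p = 2 * Re (spin_form r (\<psi> p) (spinor_deriv X \<psi> p))"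
    by blast+
qed

end

section \<open>Sasakian quasi-Killing spinors\<close>

context atlas_manifold begin

text \<open>Metric compatibility of \<phi> at (\<xi>, X) gives the claim once \<phi> \<xi> = 0. For
  that, evaluating \<phi> three times on \<xi> in two ways shows that \<phi> \<xi> is a multiple
  \<open>u\<close> of \<xi>.\<close>

lemma contact_metric_eta:
  assumes S: "contact_metric A \<phi> \<xi> \<eta> g" and X: "X \<in> vfields A"
  shows "g \<xi> X = \<eta> X"
proof -
  note c = S[unfolded contact_metric_def]
  have xi: "\<xi> \<in> vfields A" and eta1: "\<eta> \<xi> = (\<lambda>p. 1)" and endo: "endomorphism_field A \<phi>"
    and form: "one_form A \<eta>"
    and sq: "\<And>X. X \<in> vfields A \<Longrightarrow> \<phi> (\<phi> X) = vdiff (vscale (\<eta> X) \<xi>) X"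
    and comp: "\<And>X Y p. X \<in> vfields A \<Longrightarrow> Y \<in> vfields A \<Longrightarrow>
      g (\<phi> X) (\<phi> Y) p = g X Y p - \<eta> X p * \<eta> Y p"
    and riem: "riemannian_metric A g"
    using c by blast+
  have phi_in: "\<phi> X \<in> vfields A" if "X \<in> vfields A" for X
    using endo that by (simp add: endomorphism_field_def)
  have phi_scale: "\<phi> (vscale u X) = vscale u (\<phi> X)" if "smooth A u" "X \<in> vfields A" for u X
    using endo that by (simp add: endomorphism_field_def)
  have phi_0: "\<phi> (\<lambda>f p. 0) = (\<lambda>f p. 0)"
    using phi_scale[OF smooth_const xi, of 0] by (simp add: vscale_zero)
  define u where "u = \<eta> (\<phi> \<xi>)"
  have u: "smooth A u"
    using form phi_in[OF xi] by (simp add: one_form_def u_def)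
  have phi2: "\<phi> (\<phi> \<xi>) = (\<lambda>f p. 0)"
    using sq[OF xi] by (simp add: eta1 vdiff_def vscale_def)
  have "\<phi> (\<phi> (\<phi> \<xi>)) = vdiff (vscale u \<xi>) (\<phi> \<xi>)"
    using sq[OF phi_in[OF xi]] by (simp add: u_def)
  then have phi_xi: "\<phi> \<xi> = vscale u \<xi>"
    by (simp add: phi2 phi_0 vdiff_def fun_eq_iff)
  \<comment> \<open>Hence \<open>0 = \<phi> (\<phi> \<xi>) = u\<^sup>2 \<xi>\<close>, and \<open>\<eta>\<close> applied to this gives \<open>u = 0\<close>.\<close>
  have "vscale (\<lambda>p. u p * u p) \<xi> = (\<lambda>f p. 0)"
    using phi2 phi_scale[OF u xi] by (simp add: phi_xi vscale_vscale)
  moreover have "\<eta> (vscale (\<lambda>p. u p * u p) \<xi>) = (\<lambda>p. u p * u p * 1)"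
    using form xi smooth_mult[OF u u] eta1 by (simp add: one_form_def)
  moreover have eta_0: "\<eta> (\<lambda>f p. 0) = (\<lambda>p. 0)"
    using form xi smooth_const[of "0 :: real"] by (simp add: one_form_def vscale_zero(1)[symmetric, of \<xi>])
  ultimately have "(\<lambda>p. u p * u p) = (\<lambda>p. 0)" by simp
  then have "u = (\<lambda>p. 0)" by (simp add: fun_eq_iff)
  then have xi0: "\<phi> \<xi> = (\<lambda>f p. 0)" by (simp add: phi_xi vscale_zero)
  \<comment> \<open>\<open>one_form\<close> gives linearity in the second slot; symmetry moves the
    zero field \<phi> \<xi> there.\<close>
  have sym: "g (\<phi> X) (\<lambda>f p. 0) = g (\<lambda>f p. 0) (\<phi> X)"
    using riem phi_in[OF X] phi_in[OF xi] xi0 by (simp add: riemannian_metric_def)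
  have "one_form A (g (\<phi> X))" using riem phi_in[OF X] by (simp add: riemannian_metric_def)
  then have "g (\<phi> X) (vscale (\<lambda>p. 0) \<xi>) = (\<lambda>p. 0 * g (\<phi> X) \<xi> p)"
    using xi smooth_const[of "0 :: real"] unfolding one_form_def by blast
  then have "g (\<phi> \<xi>) (\<phi> X) p = 0" for p
    by (simp add: xi0 sym[symmetric] vscale_zero)
  then show ?thesis
    using comp[OF xi X] by (simp add: eta1 fun_eq_iff)
qed

text \<open>The last part rests on \<open>1 - 2 * r = (-1) ^ r\<close> for
  \<open>r \<in> {0, 1}\<close>; it identifies \<eta> with the coframe element of index 1.\<close>

lemma sasakian_metric:
  assumes S: "sasakian r A \<phi> \<xi> \<eta> g" and r: "r \<in> {0, 1}"
  shows "X \<in> vfields A \<Longrightarrow> one_form A (g X)"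
    and "X \<in> vfields A \<Longrightarrow> Y \<in> vfields A \<Longrightarrow> g X Y = g Y X"
    and "X \<in> vfields A \<Longrightarrow> g \<xi> X p = (-1) ^ r * \<eta> X p"
proof -
  obtain g' where contact: "contact_metric A \<phi> \<xi> \<eta> g'"
    and g: "\<And>X Y. X \<in> vfields A \<Longrightarrow> Y \<in> vfields A \<Longrightarrow> g X Y = (\<lambda>p. g' X Y p - 2 * real r * \<eta> X p * \<eta> Y p)"
    using S unfolding sasakian_def riemannian_sasakian_def fun_eq_iff by blast
  note c = contact[unfolded contact_metric_def]
  have xi: "\<xi> \<in> vfields A" and eta1: "\<eta> \<xi> = (\<lambda>p. 1)"
    and form: "one_form A \<eta>" and riem: "riemannian_metric A g'"
    using c by blast+
  show "g X Y = g Y X" if "X \<in> vfields A" "Y \<in> vfields A"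
    using riem that by (simp add: g riemannian_metric_def mult_ac)
  show "g \<xi> X p = (-1) ^ r * \<eta> X p" if "X \<in> vfields A"
    using r by (auto simp: g xi that contact_metric_eta[OF contact that] eta1)
  show "one_form A (g X)" if X: "X \<in> vfields A"
  proof -
    have g'X: "one_form A (g' X)" using riem X by (simp add: riemannian_metric_def)
    show ?thesis
      unfolding one_form_def
    proof (intro conjI ballI allI impI)
      show "smooth A (g X Y)" if "Y \<in> vfields A" for Y
        using g'X form X that
        by (auto simp: g one_form_def intro!: smooth_diff smooth_mult smooth_const)
      show "g X (vadd Y Z) = (\<lambda>p. g X Y p + g X Z p)" if "Y \<in> vfields A" "Z \<in> vfields A" for Y Z
        using g'X form X that by (simp add: g vadd_in one_form_def algebra_simps)
      show "g X (vscale u Y) = (\<lambda>p. u p * g X Y p)" if "Y \<in> vfields A" "smooth A u" for u Y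
        using g'X form X that by (simp add: g vscale_in one_form_def algebra_simps)
    qed
  qed
qed

end

lemma clifford_vec_diff: "clifford_vec r x v - clifford_vec r y v = clifford_vec r (\<lambda>j. x j - y j) v"
  by (simp add: clifford_vec_def vec_eq_iff algebra_simps sum_subtractf)

lemma clifford_vec_cscale: "clifford_vec r x (c *s v) = c *s clifford_vec r x v"
  by (simp add: clifford_vec_def vec_eq_iff vector_scalar_commute sum_distrib_left mult_ac)

lemma gam_square:
  assumes "r \<in> {0, 1}"
  shows "gam r j *v (gam r j *v v) = complex_of_real (- hdiag r j) *s v"
  using exhaust_3[of j] assms by (auto simp: vec2_eq_iff gam_mult hdiag_def)

section \<open>Dirac operator and energy-momentum tensor of an SqK-spinor\<close>

context sasakian_framed begin

text \<open>Frame coefficients of the vector a X + b \<eta>(X) \<xi>, since \<xi> is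
  \<open>e 1\<close> and \<eta> is its dual.\<close>

definition sqk_vec :: "real \<Rightarrow> real \<Rightarrow> 'm vfield \<Rightarrow> 'm \<Rightarrow> 3 \<Rightarrow> real" where
  "sqk_vec a b X p j = a * coframe r g e j X p + (if j = 1 then b * coframe r g e 1 X p else 0)"

lemma sqk_spinor_iff:
  assumes eta: "\<forall>X\<in>vfields A. \<forall>p. \<eta> X p = coframe r g e 1 X p"
  shows "sqk_spinor r H A \<xi> \<eta> g e a b \<psi> \<longleftrightarrow> smooth A \<psi> \<and>
    (\<forall>X\<in>vfields A. \<forall>p. spin_nabla r H g e X \<psi> p = \<i> ^ r *s clifford_vec r (sqk_vec a b X p) (\<psi> p))"
proof -
  have "(complex_of_real a * \<i> ^ r) *s clifford r g e X \<psi> p +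
        (complex_of_real b * \<i> ^ r * complex_of_real (\<eta> X p)) *s clifford r g e \<xi> \<psi> p =
      \<i> ^ r *s clifford_vec r (sqk_vec a b X p) (\<psi> p)" if "X \<in> vfields A" for X p
    unfolding clifford_eq clifford_vec_def sum_3 sqk_vec_def frame_1[symmetric] coframe_frame bspec[OF eta that, rule_format]
    by (simp add: vec_eq_iff algebra_simps)
  then show ?thesis
    unfolding sqk_spinor_def by (metis (no_types, lifting))
qed

context
  fixes a b :: real and \<psi> :: "'m spinor"
  assumes r01: "r \<in> {0, 1}" and smooth_\<psi>: "smooth A \<psi>"
    and sqk: "\<forall>X\<in>vfields A. \<forall>p.
      spin_nabla r H g e X \<psi> p = \<i> ^ r *s clifford_vec r (sqk_vec a b X p) (\<psi> p)"
begin

lemma spin_form_constant: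
  assumes "connected (UNIV :: 'm set)"
  shows "Re (spin_form r (\<psi> p) (\<psi> p)) = Re (spin_form r (\<psi> q) (\<psi> q))"
proof (rule constant_if_vfields_vanish[OF assms Re_spin_form_deriv(1)[OF frame_in smooth_\<psi> r01],
      where p = p and q = q])
  fix X assume X: "X \<in> vfields A"
  show "X (\<lambda>p. Re (spin_form r (\<psi> p) (\<psi> p))) = (\<lambda>p. 0)"
  proof
    fix p
    have "spinor_deriv X \<psi> p = spin_nabla r H g e X \<psi> p - omegaS r H g e X p *v \<psi> p"
      by (simp add: spin_nabla_def)
    \<comment> \<open>Both terms are \<open>\<i> ^ r\<close> times a real Clifford vector;
      \<open>x\<close> is the difference of the two coefficient vectors.\<close>
    also obtain x where "\<dots> = \<i> ^ r *s clifford_vec r x (\<psi> p)"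
      unfolding bspec[OF sqk X, rule_format] omegaS_mult[OF r01] vector_sub_rdistrib[symmetric]
      by (metis (no_types) clifford_vec_diff vector_ssub_ldistrib)
    finally show "X (\<lambda>p. Re (spin_form r (\<psi> p) (\<psi> p))) p = 0"
      by (simp add: Re_spin_form_deriv(2)[OF X smooth_\<psi> r01] Re_spin_form_clifford[OF r01])
  qed
qed

lemma dirac_sqk: "dirac r H g e \<psi> p = complex_of_real (- ((-1) ^ r) * (3 * a + b)) *s \<psi> p"
proof -
  \<comment> \<open>The Killing number in direction \<open>e j\<close>: the Reeb direction gets the
    additional \<open>b\<close>, so the three sum to \<open>3 * a + b\<close>. Raising the index of
    \<open>gam r j\<close> cancels the sign \<open>hdiag r j\<close> of its square.\<close>
  define t where "t j = complex_of_real (a + (if j = 1 then b else 0))" for j :: 3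
  have "complex_of_real (hdiag r j) *s (gam r j *v spin_nabla r H g e (e j) \<psi> p) =
      (- (\<i> ^ r) * t j) *s \<psi> p" for j
  proof -
    have nab: "spin_nabla r H g e (e j) \<psi> p = \<i> ^ r *s (t j *s (gam r j *v \<psi> p))"
      unfolding t_def using exhaust_3[of j]
      by (auto simp: bspec[OF sqk frame_in, rule_format] clifford_vec_def sqk_vec_def coframe_frame sum_3)
    have coeff: "D * (w * (s * - D)) = - w * s" if "D * D = 1" for D w s :: complex
    proof -
      have "D * (w * (s * - D)) = - w * s * (D * D)" by (simp add: mult_ac)
      then show ?thesis by (simp add: that)
    qed
    have "complex_of_real (hdiag r j) * complex_of_real (hdiag r j) = 1"
      by (simp add: hdiag_sq flip: of_real_mult)
    from coeff[OF this, of "\<i> ^ r" "t j"] show ?thesis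
      by (simp only: nab vector_scalar_commute gam_square[OF r01] vector_smult_assoc mult.assoc of_real_minus)
  qed
  then have "dirac r H g e \<psi> p = (- (\<i> ^ r * \<i> ^ r) * (t 1 + t 2 + t 3)) *s \<psi> p"
    by (simp add: dirac_def sum_3 vec_eq_iff algebra_simps)
  moreover have "\<i> ^ r * \<i> ^ r = complex_of_real ((-1) ^ r)"
    using r01 by auto
  moreover have "t 1 + t 2 + t 3 = complex_of_real (3 * a + b)"
    by (simp add: t_def)
  ultimately show ?thesis by simp
qed

text \<open>The two summands of \<open>T\<close> contribute equally, turning 1/4 into 1/2. The
  \<open>b\<close> term carries no sign because \<open>(-1) ^ r\<close> meets
  \<open>hdiag r 1\<close>, which equals it.\<close>

lemma T_spin_sqk:
  assumes X: "X \<in> vfields A" and Y: "Y \<in> vfields A"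
  shows "T_spin r H g e \<psi> X Y p = - (1 / 2) * Re (spin_form r (\<psi> p) (\<psi> p)) *
    ((-1) ^ r * a * g X Y p + b * coframe r g e 1 X p * coframe r g e 1 Y p)"
proof -
  have "T_spin r H g e \<psi> X Y p = 1 / 4 *
    (Re (spin_form r (\<psi> p) (\<i> ^ r *s clifford_vec r (\<lambda>j. coframe r g e j X p) (\<i> ^ r *s clifford_vec r (sqk_vec a b Y p) (\<psi> p)))) +
     Re (spin_form r (\<psi> p) (\<i> ^ r *s clifford_vec r (\<lambda>j. coframe r g e j Y p) (\<i> ^ r *s clifford_vec r (sqk_vec a b X p) (\<psi> p)))))"
    by (simp add: T_spin_def clifford_eq bspec[OF sqk X, rule_format] bspec[OF sqk Y, rule_format] vector_add_ldistrib spin_form_add[OF r01])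
  then show ?thesis
    unfolding Re_spin_form_clifford_clifford[OF r01]
    using eps_sq by (simp add: metric_expansion[OF X Y] sqk_vec_def sum_3 hdiag_def algebra_simps)
qed

end

text \<open>\<open>ric_g\<close> and \<open>ric_eta\<close> compare the coefficients of
  \<open>g\<close> and of \<eta> \<otimes> \<eta>. Subtracting the trace,
  \<open>- N / 2 * (-1) ^ r * (3 * a + b)\<close>, changes the factor \<open>- a\<close> of
  \<open>g\<close> into \<open>2 * a + b\<close>.\<close>

lemma sqk_ED_solution:
  assumes r: "r \<in> {0, 1}"
    and eta: "\<forall>X\<in>vfields A. \<forall>p. \<eta> X p = coframe r g e 1 X p"
    and sqk: "sqk_spinor r H A \<xi> \<eta> g e a b \<psi>"
    and norm: "\<And>p. Re (spin_form r (\<psi> p) (\<psi> p)) = N"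
    and lam: "lam = - ((-1) ^ r) * (3 * a + b)"
    and ric_g: "H + (-1) ^ r = N * (2 * (-1) ^ r * a + (-1) ^ r * b) / 2 + 2 * Lam"
    and ric_eta: "1 - (-1) ^ r * H = - N * b / 2"
  shows "ED_solution r H A g e nabla \<psi> lam Lam"
proof -
  from sqk have smooth: "smooth A \<psi>"
    and nab: "\<forall>X\<in>vfields A. \<forall>p.
      spin_nabla r H g e X \<psi> p = \<i> ^ r *s clifford_vec r (sqk_vec a b X p) (\<psi> p)"
    by (simp_all add: sqk_spinor_iff[OF eta])
  note T = T_spin_sqk[OF r smooth nab, unfolded norm]
  have tr: "metric_trace r e (T_spin r H g e \<psi>) p = - (1 / 2) * N * (-1) ^ r * (3 * a + b)" for p
    using eps_sq
    by (simp add: metric_trace_def sum_3 T frame_in frame_metric coframe_frame hdiag_def algebra_simps)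
  show ?thesis
    unfolding ED_solution_def
  proof (intro conjI ballI allI)
    show "smooth A \<psi>" by (rule smooth)
    show "dirac r H g e \<psi> p = complex_of_real lam *s \<psi> p" for p
      using dirac_sqk[OF r smooth nab] lam by simp
    fix X Y p assume X: "X \<in> vfields A" and Y: "Y \<in> vfields A"
    show "ricci r g e nabla X Y p =
          T_spin r H g e \<psi> X Y p - metric_trace r e (T_spin r H g e \<psi>) p * g X Y p + 2 * Lam * g X Y p"
      unfolding ricci_eq[OF X Y] ric_eta ric_g tr T[OF X Y] by (simp add: algebra_simps)
  qed
qed

lemma sqk_scale:
  assumes eta: "\<forall>X\<in>vfields A. \<forall>p. \<eta> X p = coframe r g e 1 X p"
    and "sqk_spinor r H A \<xi> \<eta> g e a b \<psi>"
  shows "sqk_spinor r H A \<xi> \<eta> g e a b (\<lambda>p. complex_of_real c *s \<psi> p)"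
proof -
  from assms(2) have smooth: "smooth A \<psi>"
    and nab: "\<forall>X\<in>vfields A. \<forall>p.
      spin_nabla r H g e X \<psi> p = \<i> ^ r *s clifford_vec r (sqk_vec a b X p) (\<psi> p)"
    by (simp_all add: sqk_spinor_iff[OF eta])
  have "spin_nabla r H g e X (\<lambda>p. complex_of_real c *s \<psi> p) p = complex_of_real c *s spin_nabla r H g e X \<psi> p"
    if "X \<in> vfields A" for X p
    by (simp add: spin_nabla_def spinor_deriv_scale[OF that smooth] vector_scalar_commute vector_add_ldistrib)
  then show ?thesis
    by (simp add: sqk_spinor_iff[OF eta] smooth_scale[OF smooth] nab clifford_vec_cscale mult.commute)
qed

end

section \<open>Solutions of the Einstein-Dirac system\<close>

lemma einstein_dirac_coefficients:
  fixes H a b lam Lam N :: real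
  assumes r: "r \<in> {0, 1}"
    and cases:
      "(a = (-1) ^ r / 2 \<and> b = (H - (-1) ^ r) / 4 \<and>
        lam = ((-1) powi (int r - 1) * H - 5) / 4 \<and>
        Lam = (-1) powi (int r - 1))
       \<or>
       ((-1) ^ r * H > -3 \<and>
        a = (-1) ^ r / 2 + sqrt ((-1) ^ r * H + 3) / 2 \<and>
        b = - (sqrt ((-1) ^ r * H + 3) / 2) + (-1) powi (int r - 1) \<and>
        lam = (-1) powi (int r - 1) * sqrt ((-1) ^ r * H + 3) - 1 / 2 \<and>
        Lam = - sqrt (3 + (-1) ^ r * H) + H + (-1) ^ r * 2 \<and>
        (r = 0 \<longrightarrow> H < 1))
       \<or>
       ((-1) ^ r * H > -3 \<and>
        a = (-1) ^ r / 2 - sqrt ((-1) ^ r * H + 3) / 2 \<and>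
        b = sqrt ((-1) ^ r * H + 3) / 2 + (-1) powi (int r - 1) \<and>
        lam = (-1) ^ r * sqrt ((-1) ^ r * H + 3) - 1 / 2 \<and>
        Lam = sqrt (3 + (-1) ^ r * H) + H + (-1) ^ r * 2)"
    and lam: "lam \<noteq> 0"
    and N: "N * lam = - (2 * H + 4 * (-1) ^ r - 6 * Lam)"
  shows "lam = - ((-1) ^ r) * (3 * a + b)"
    and "H + (-1) ^ r = N * (2 * (-1) ^ r * a + (-1) ^ r * b) / 2 + 2 * Lam"
    and "1 - (-1) ^ r * H = - N * b / 2"
    and "r = 0 \<longrightarrow> N > 0"
proof -
  define \<epsilon> :: real where "\<epsilon> = (-1) ^ r"
  have \<epsilon>: "\<epsilon> = 1 \<and> r = 0 \<or> \<epsilon> = - 1 \<and> r \<noteq> 0" and pw: "(-1) powi (int r - 1) = - \<epsilon>"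
    using r by (auto simp: \<epsilon>_def power_int_minus)
  define s where "s = sqrt (\<epsilon> * H + 3)"
  have s: "sqrt (3 + \<epsilon> * H) = s" by (simp add: s_def add.commute)
  note cases' = cases[folded \<epsilon>_def, unfolded pw s, folded s_def]
  note N' = N[folded \<epsilon>_def]
  \<comment> \<open>As \<open>lam\<close> is nonzero, a closed form guessed for \<open>N\<close> is
    verified by multiplying out.\<close>
  have lamI: "N = K" if "K * lam = - (2 * H + 4 * \<epsilon> - 6 * Lam)" for K
    using that N' lam by (metis mult_cancel_right)
  have "lam = - \<epsilon> * (3 * a + b) \<and> H + \<epsilon> = N * (2 * \<epsilon> * a + \<epsilon> * b) / 2 + 2 * Lam \<and>
    1 - \<epsilon> * H = - N * b / 2 \<and> (r = 0 \<longrightarrow> N > 0)"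
    using cases'
  proof (elim disjE conjE)
    assume c: "a = \<epsilon> / 2" "b = (H - \<epsilon>) / 4" "lam = (- \<epsilon> * H - 5) / 4" "Lam = - \<epsilon>"
    have "N = 8 * \<epsilon>"
      by (rule lamI) (use \<epsilon> in \<open>auto simp: c field_simps\<close>)
    then show ?thesis using \<epsilon> by (auto simp: c field_simps)
  next
    assume H: "- 3 < \<epsilon> * H" and less: "r = 0 \<longrightarrow> H < 1"
    assume c: "a = \<epsilon> / 2 + s / 2" "b = - (s / 2) + - \<epsilon>" "lam = - \<epsilon> * s - 1 / 2"
      "Lam = - s + H + \<epsilon> * 2"
    have ss: "s * s = \<epsilon> * H + 3" using H by (simp add: s_def)
    \<comment> \<open>Eliminating \<open>H\<close> leaves polynomial identities in \<open>s\<close>;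
      the \<eta> \<otimes> \<eta> equation becomes the factorisation of
      \<open>4 - s * s\<close>.\<close>
    then have H': "H = \<epsilon> * (s * s - 3)" using \<epsilon> by auto
    have N_eq: "N = 4 * (2 * \<epsilon> - s)"
      by (rule lamI) (use \<epsilon> in \<open>auto simp: c H' algebra_simps\<close>)
    \<comment> \<open>Here \<open>H < 1\<close> is used: for \<open>r = 0\<close> it makes
      \<open>N = 4 * (2 - s)\<close> positive.\<close>
    have "s < 2" if "r = 0"
      using less that \<epsilon> real_sqrt_less_mono[of "H + 3" 4] by (auto simp: s_def)
    then show ?thesis using \<epsilon> by (auto simp: N_eq c H' field_simps)
  next
    assume H: "- 3 < \<epsilon> * H"
    assume c: "a = \<epsilon> / 2 - s / 2" "b = s / 2 + - \<epsilon>" "lam = \<epsilon> * s - 1 / 2"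
      "Lam = s + H + \<epsilon> * 2"
    have ss: "s * s = \<epsilon> * H + 3" and "s \<ge> 0" using H by (simp_all add: s_def)
    then have H': "H = \<epsilon> * (s * s - 3)" using \<epsilon> by auto
    have N_eq: "N = 4 * (2 * \<epsilon> + s)"
      by (rule lamI) (use \<epsilon> in \<open>auto simp: c H' algebra_simps\<close>)
    show ?thesis using \<epsilon> \<open>s \<ge> 0\<close> by (auto simp: N_eq c H' field_simps)
  qed
  then show "lam = - ((-1) ^ r) * (3 * a + b)"
    and "H + (-1) ^ r = N * (2 * (-1) ^ r * a + (-1) ^ r * b) / 2 + 2 * Lam"
    and "1 - (-1) ^ r * H = - N * b / 2"
    and "r = 0 \<longrightarrow> N > 0"
    unfolding \<epsilon>_def by blast+
qed

text \<open>\<open>real_root\<close> makes the scaling factor an honest root in the Lorentzian case: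
  \<open>sqrt\<close> of a negative real is a negative real, whose square has the wrong sign. For
  \<open>r = 0\<close> nonnegativity is proved.\<close>

theorem proposition4p6:
  fixes r :: nat
    and A :: "('m::{t2_space, second_countable_topology}) atlas"
    and \<phi> :: "'m vfield \<Rightarrow> 'm vfield"
    and \<xi> :: "'m vfield"
    and \<eta> :: "'m vfield \<Rightarrow> 'm \<Rightarrow> real"
    and g :: "'m metric"
    and nabla :: "'m connection"
    and e :: "3 \<Rightarrow> 'm vfield"
    and \<psi> :: "'m spinor"
    and H a b lam Lam :: real
    and radicand :: "'m \<Rightarrow> real"
  defines "radicand \<equiv> \<lambda>p. - ((scalar_curvature r g e nabla p - 6 * Lam)
                              / (lam * Re (spin_form r (\<psi> p) (\<psi> p))))"
  assumes r: "r \<in> {0, 1}"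
    and space_form: "sasakian_space_form r A \<phi> \<xi> \<eta> g nabla H"
    and frame: "sasakian_frame r H A \<xi> g e"
    and sqk: "sqk_spinor r H A \<xi> \<eta> g e a b \<psi>"
    and non_null: "\<forall>p. spin_form r (\<psi> p) (\<psi> p) \<noteq> 0"
    and cases:
      "(a = (-1) ^ r / 2 \<and> b = (H - (-1) ^ r) / 4 \<and>
        lam = ((-1) powi (int r - 1) * H - 5) / 4 \<and>
        Lam = (-1) powi (int r - 1))
       \<or>
       ((-1) ^ r * H > -3 \<and>
        a = (-1) ^ r / 2 + sqrt ((-1) ^ r * H + 3) / 2 \<and>
        b = - (sqrt ((-1) ^ r * H + 3) / 2) + (-1) powi (int r - 1) \<and>
        lam = (-1) powi (int r - 1) * sqrt ((-1) ^ r * H + 3) - 1 / 2 \<and>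
        Lam = - sqrt (3 + (-1) ^ r * H) + H + (-1) ^ r * 2 \<and>
        (r = 0 \<longrightarrow> H < 1))
       \<or>
       ((-1) ^ r * H > -3 \<and>
        a = (-1) ^ r / 2 - sqrt ((-1) ^ r * H + 3) / 2 \<and>
        b = sqrt ((-1) ^ r * H + 3) / 2 + (-1) powi (int r - 1) \<and>
        lam = (-1) ^ r * sqrt ((-1) ^ r * H + 3) - 1 / 2 \<and>
        Lam = sqrt (3 + (-1) ^ r * H) + H + (-1) ^ r * 2)"
    and lam_nz: "lam \<noteq> 0"
    and S_nz: "\<forall>p. scalar_curvature r g e nabla p - 6 * Lam \<noteq> 0"
    and real_root: "r = 1 \<longrightarrow> (\<forall>p. radicand p \<ge> 0)"
  shows "ED_solution r H A g e nabla (\<lambda>p. complex_of_real (sqrt (radicand p)) *s \<psi> p) lam Lam"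
proof -
  have atlas: "smooth_atlas A" and sc: "simply_connected (UNIV :: 'm set)"
    and sasakian: "sasakian r A \<phi> \<xi> \<eta> g" and lc: "levi_civita A g nabla"
    using space_form by (simp_all add: sasakian_space_form_def)
  interpret atlas_manifold A by standard (rule atlas)
  have "affine_connection A nabla" using lc by (simp add: levi_civita_def)
  interpret sasakian_framed A nabla r H \<xi> g e
    by standard (use \<open>affine_connection A nabla\<close> sasakian_metric[OF sasakian r] frame lc in auto)
  have eta: "\<forall>X\<in>vfields A. \<forall>p. \<eta> X p = coframe r g e 1 X p"
    using sasakian_metric(3)[OF sasakian r] eps_sq
    by (simp add: coframe_def hdiag_def frame_1 mult.assoc[symmetric])
  have smooth: "smooth A \<psi>"
    and nab: "\<forall>X\<in>vfields A. \<forall>p.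
      spin_nabla r H g e X \<psi> p = \<i> ^ r *s clifford_vec r (sqk_vec a b X p) (\<psi> p)"
    using sqk by (simp_all add: sqk_spinor_iff[OF eta])
  \<comment> \<open>\<open>undefined\<close> serves as an arbitrary base point.\<close>
  define n where "n = Re (spin_form r (\<psi> undefined) (\<psi> undefined))"
  have n: "Re (spin_form r (\<psi> p) (\<psi> p)) = n" for p
    unfolding n_def
    by (rule spin_form_constant[OF r smooth nab simply_connected_imp_connected_UNIV[OF sc]])
  have n_nz: "n \<noteq> 0"
    using non_null spin_form_real[OF r] n complex_eq_iff by (metis zero_complex.sel)
  define N where "N = - ((2 * H + 4 * (-1) ^ r - 6 * Lam) / lam)"
  have N: "N * lam = - (2 * H + 4 * (-1) ^ r - 6 * Lam)"
    using lam_nz by (simp add: N_def)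
  note coeff = einstein_dirac_coefficients[OF r cases lam_nz N]
  \<comment> \<open>The radicand is thus independent of \<open>p\<close>, so the spinor is rescaled
    by a constant and stays SqK of the same type.\<close>
  have rad: "radicand p = N / n" for p
    by (simp add: radicand_def scalar_curvature_eq n N_def)
  have "N / n \<ge> 0"
  proof (cases "r = 0")
    case True
    have "n \<ge> 0"
      using spin_form_eq[OF r, of "\<psi> undefined" "\<psi> undefined"] True by (simp add: n_def)
    then show ?thesis using coeff(4) True by simp
  next
    case False
    then show ?thesis using real_root rad r by auto
  qed
  then have norm: "Re (spin_form r (complex_of_real (sqrt (N / n)) *s \<psi> p)
      (complex_of_real (sqrt (N / n)) *s \<psi> p)) = N" for p
    using n_nz by (simp add: spin_form_scale[OF r] n flip: of_real_power)
  show ?thesis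
    unfolding rad
    by (rule sqk_ED_solution[OF r eta sqk_scale[OF eta sqk] norm coeff(1-3)])
qed

end
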